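(* Let $p$ be a prime, let $F$ be a finite field of characteristic $p$, and let $G$ be a finite group of $p$-power order. Then the group of normalized units $V(FG)$ of the group algebra $FG$ is powerful if and only if $G$ is abelian.
   Context: For a finite $p$-group $G$ and a finite field $F$ of characteristic $p$, the group of normalized units of the group algebra $FG$ is $V(FG)=\{\sum_{g\in G}\alpha_g g\in FG \mid \sum_{g\in G}\alpha_g=1\}$, a group under the multiplication of $FG$; it is a finite $p$-group of order $|F|^{|G|-1}$. A finite $p$-group $P$ is called powerful if every commutator $(a,b)=a^{-1}b^{-1}ab$ with $a,b\in P$ is a product of $p$-th powers of elements of $P$ when $p$ is odd, and a product of fourth powers of elements of $P$ when $p=2$. *)

theory Defs
  imports "HOL-Algebra.Algebra"
begin

text \<open>
  The group algebra for a finite group: a formal sum of \<open>\<alpha>\<^sub>g g\<close> is represented by its coefficient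
  function \<open>g \<mapsto> \<alpha>\<^sub>g\<close>, extensional outside \<open>carrier G\<close>. No finite-support condition is imposed, so
  the definition is meant for finite \<open>G\<close> only.
\<close>

definition group_algebra ::
  "('f, 'r) ring_scheme \<Rightarrow> ('g, 'm) monoid_scheme \<Rightarrow> ('g \<Rightarrow> 'f) ring" where
  "group_algebra F G =
    \<lparr> carrier = carrier G \<rightarrow>\<^sub>E carrier F,
      monoid.mult = (\<lambda>u v. \<lambda>g\<in>carrier G.
        \<Oplus>\<^bsub>F\<^esub>h\<in>carrier G. u h \<otimes>\<^bsub>F\<^esub> v (inv\<^bsub>G\<^esub> h \<otimes>\<^bsub>G\<^esub> g)),
      monoid.one = (\<lambda>g\<in>carrier G. if g = \<one>\<^bsub>G\<^esub> then \<one>\<^bsub>F\<^esub> else \<zero>\<^bsub>F\<^esub>),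
      ring.zero = (\<lambda>g\<in>carrier G. \<zero>\<^bsub>F\<^esub>),
      ring.add = (\<lambda>u v. \<lambda>g\<in>carrier G. u g \<oplus>\<^bsub>F\<^esub> v g) \<rparr>"

definition normalized_units ::
  "('f, 'r) ring_scheme \<Rightarrow> ('g, 'm) monoid_scheme \<Rightarrow> ('g \<Rightarrow> 'f) monoid" where
  "normalized_units F G =
    \<lparr> carrier = {u \<in> carrier (group_algebra F G). (\<Oplus>\<^bsub>F\<^esub>g\<in>carrier G. u g) = \<one>\<^bsub>F\<^esub>},
      monoid.mult = monoid.mult (group_algebra F G),
      monoid.one = monoid.one (group_algebra F G) \<rparr>"

definition ring_char :: "('f, 'r) ring_scheme \<Rightarrow> nat" where
  "ring_char R =
    (if \<exists>n::nat. n > 0 \<and> [n] \<cdot>\<^bsub>R\<^esub> \<one>\<^bsub>R\<^esub> = \<zero>\<^bsub>R\<^esub>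
     then LEAST n::nat. n > 0 \<and> [n] \<cdot>\<^bsub>R\<^esub> \<one>\<^bsub>R\<^esub> = \<zero>\<^bsub>R\<^esub> else 0)"

definition finite_p_group :: "nat \<Rightarrow> ('g, 'm) monoid_scheme \<Rightarrow> bool" where
  "finite_p_group p G \<longleftrightarrow> group G \<and> finite (carrier G) \<and> (\<exists>n. order G = p ^ n)"

definition commutator :: "('g, 'm) monoid_scheme \<Rightarrow> 'g \<Rightarrow> 'g \<Rightarrow> 'g" where
  "commutator G a b = inv\<^bsub>G\<^esub> a \<otimes>\<^bsub>G\<^esub> inv\<^bsub>G\<^esub> b \<otimes>\<^bsub>G\<^esub> a \<otimes>\<^bsub>G\<^esub> b"

definition is_product_of_powers :: "('g, 'm) monoid_scheme \<Rightarrow> nat \<Rightarrow> 'g \<Rightarrow> bool" where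
  "is_product_of_powers G k c \<longleftrightarrow>
    (\<exists>xs. set xs \<subseteq> carrier G \<and> c = foldr (\<otimes>\<^bsub>G\<^esub>) (map (\<lambda>x. x [^]\<^bsub>G\<^esub> k) xs) \<one>\<^bsub>G\<^esub>)"

definition powerful :: "nat \<Rightarrow> ('g, 'm) monoid_scheme \<Rightarrow> bool" where
  "powerful p P \<longleftrightarrow> finite_p_group p P \<and>
    (\<forall>a\<in>carrier P. \<forall>b\<in>carrier P.
      is_product_of_powers P (if p = 2 then 4 else p) (commutator P a b))"

end

theory Submission
  imports Defs
begin

text \<open>
  If \<open>G\<close> is abelian, then so is \<open>FG\<close>, and the Frobenius identity \<open>(a + b)\<^sup>p = a\<^sup>p + b\<^sup>p\<close> gives
  \<open>u\<^sup>q = (\<Sum>\<alpha>\<^sub>g)\<^sup>q\<close> for \<open>u = \<Sum>\<alpha>\<^sub>g g\<close> and \<open>q = |G|\<close>. So every normalized unit \<open>u\<close> satisfies \<open>u\<^sup>q = 1\<close>;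
  hence \<open>V(FG)\<close> is an abelian \<open>p\<close>-group, and its commutators are empty products.

  Conversely, let \<open>G\<close> be nonabelian. Among the nonabelian quotients of \<open>G\<close> take a smallest one, \<open>H\<close>
  (\<open>nonabelian_p_group_minimal_quotient\<close>). It has a central element \<open>z\<close> of order \<open>p\<close> such that all
  commutators of \<open>H\<close> are powers of \<open>z\<close>. In \<open>R = FH\<close> the element \<open>t = z - 1\<close> is central with
  \<open>t\<^sup>p = 0\<close>, and every Lie bracket \<open>uv - vu\<close> lies in \<open>tR\<close>. Hence \<open>(ad u)\<^sup>p\<close> maps \<open>R\<close> into
  \<open>t\<^sup>pR = 0\<close>. In characteristic \<open>p\<close> we have \<open>ad(u\<^sup>p) = (ad u)\<^sup>p\<close>, so that all \<open>p\<close>-th powers of \<open>R\<close> are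
  central (\<open>pow_p_commutes\<close>). For \<open>p = 2\<close> more is true: a square is congruent modulo \<open>tR\<close> to an
  element supported on the center of \<open>H\<close>, and squaring once more kills the \<open>tR\<close>-part, so fourth
  powers are supported on the center (\<open>fourth_power_center_supported\<close>). Both properties are inherited
  by products.

  It remains to find a commutator without the property in question. Let \<open>g\<close>, \<open>h\<close> be
  noncommuting elements of \<open>H\<close>, with \<open>gh = \<zeta>hg\<close>, and put \<open>w = h(g - 1)\<close>. The commutator
  \<open>c = (g, 1 + w)\<close> satisfies \<open>(1 + w) c = 1 + \<zeta>w\<close>. If \<open>c\<close> commutes with \<open>g\<close>, conjugating this equation
  by \<open>g\<close> leads to \<open>(\<zeta> - 1)\<^sup>2 w = 0\<close>, which is false for \<open>p\<close> odd; if \<open>p = 2\<close> and \<open>c\<close> is supported on the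
  center, comparing coefficients at central elements gives \<open>c = 1\<close> and so \<open>(\<zeta> - 1) w = 0\<close>, which is
  false as well (\<open>no_commutator_relation\<close>). The relation between \<open>g\<close>, \<open>1 + w\<close> and \<open>c\<close> lifts to
  normalized units of \<open>FG\<close>, since \<open>FG \<rightarrow> FH\<close> is a ring homomorphism and \<open>1 + w\<close> has an evident preimage.
\<close>

section \<open>Frobenius identities in prime characteristic\<close>

text \<open>
  The binomial theorem for commuting additive operators. This form serves two purposes: with left
  multiplications it yields the Frobenius identity, and with \<open>ad u\<close> and a right multiplication it
  yields \<open>ad(u\<^sup>p) = (ad u)\<^sup>p\<close>. The induction step is Pascal's rule.
\<close>
lemma (in abelian_group) commuting_sum_funpow:
  assumes A: "\<And>x. x \<in> carrier G \<Longrightarrow> A x \<in> carrier G"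
    and B: "\<And>x. x \<in> carrier G \<Longrightarrow> B x \<in> carrier G"
    and A_add: "\<And>x y. x \<in> carrier G \<Longrightarrow> y \<in> carrier G \<Longrightarrow> A (x \<oplus> y) = A x \<oplus> A y"
    and B_add: "\<And>x y. x \<in> carrier G \<Longrightarrow> y \<in> carrier G \<Longrightarrow> B (x \<oplus> y) = B x \<oplus> B y"
    and comm: "\<And>x. x \<in> carrier G \<Longrightarrow> A (B x) = B (A x)"
    and x: "x \<in> carrier G"
  shows "((\<lambda>x. A x \<oplus> B x) ^^ n) x =
    (\<Oplus>k\<in>{..n}. [(n choose k)] \<cdot> (A ^^ k) ((B ^^ (n - k)) x))"
proof (induction n)
  case 0
  then show ?case using x by (simp add: add.nat_pow_eone)
next
  case (Suc n)
  have Ak: "(A ^^ k) y \<in> carrier G" if "y \<in> carrier G" for y k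
    using that A by (induction k) auto
  have Bk: "(B ^^ k) y \<in> carrier G" if "y \<in> carrier G" for y k
    using that B by (induction k) auto
  have BA: "B ((A ^^ k) y) = (A ^^ k) (B y)" if "y \<in> carrier G" for y k
    using that by (induction k) (auto simp: comm[symmetric] Ak)
  have zero: "D \<zero> = \<zero>" if "\<And>x. x \<in> carrier G \<Longrightarrow> D x \<in> carrier G"
    "\<And>x y. x \<in> carrier G \<Longrightarrow> y \<in> carrier G \<Longrightarrow> D (x \<oplus> y) = D x \<oplus> D y" for D
    using that(1)[of \<zero>] that(2)[of \<zero> \<zero>] add.l_cancel_one'[of "D \<zero>" "D \<zero>"] by simp
  have nat: "D ([m] \<cdot> y) = [m] \<cdot> D y" if D: "\<And>x. x \<in> carrier G \<Longrightarrow> D x \<in> carrier G"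
    "\<And>x y. x \<in> carrier G \<Longrightarrow> y \<in> carrier G \<Longrightarrow> D (x \<oplus> y) = D x \<oplus> D y"
    and y: "y \<in> carrier G" for D y and m :: nat
    using y zero[OF D] by (induction m) (auto simp: D add.nat_pow_Suc)
  have sum: "D (\<Oplus>k\<in>{..m}. f k) = (\<Oplus>k\<in>{..m}. D (f k))" 
    if D: "\<And>x. x \<in> carrier G \<Longrightarrow> D x \<in> carrier G"
      "\<And>x y. x \<in> carrier G \<Longrightarrow> y \<in> carrier G \<Longrightarrow> D (x \<oplus> y) = D x \<oplus> D y"
      and f: "\<And>k. f k \<in> carrier G" for D and f :: "nat \<Rightarrow> 'a" and m :: nat
    by (induction m) (auto simp: D f Pi_def)
  \<comment> \<open>The term of degree \<open>n + 1\<close> in which \<open>A\<close> occurs \<open>k\<close> times: both \<open>A\<close> and \<open>B\<close> send the sum for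
    \<open>n\<close> to a combination of these terms.\<close>
  define f where "f k = (A ^^ k) ((B ^^ (Suc n - k)) x)" for k
  have f: "f k \<in> carrier G" for k by (simp add: f_def Ak Bk x)
  have "((\<lambda>x. A x \<oplus> B x) ^^ Suc n) x =
      A (\<Oplus>k\<in>{..n}. [(n choose k)] \<cdot> (A ^^ k) ((B ^^ (n - k)) x)) \<oplus>
      B (\<Oplus>k\<in>{..n}. [(n choose k)] \<cdot> (A ^^ k) ((B ^^ (n - k)) x))"
    using Suc by simp
  also have "A (\<Oplus>k\<in>{..n}. [(n choose k)] \<cdot> (A ^^ k) ((B ^^ (n - k)) x)) =
      (\<Oplus>k\<in>{..n}. [(n choose k)] \<cdot> f (Suc k))"
    by (subst sum) (auto simp: A A_add Ak Bk x nat f_def)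
  also have "B (\<Oplus>k\<in>{..n}. [(n choose k)] \<cdot> (A ^^ k) ((B ^^ (n - k)) x)) =
      (\<Oplus>k\<in>{..n}. [(n choose k)] \<cdot> f k)"
    by (subst sum) (auto simp: B B_add Ak Bk x nat f_def BA Suc_diff_le Pi_def intro!: finsum_cong')
  also have "\<dots> = (\<Oplus>k\<in>{..Suc n}. [(n choose k)] \<cdot> f k)"
    by (subst finsum_Suc) (auto simp: f Pi_def binomial_eq_0)
  also have "\<dots> = (\<Oplus>k\<in>{..n}. [(n choose Suc k)] \<cdot> f (Suc k)) \<oplus> f 0"
    by (subst finsum_Suc2) (auto simp: f Pi_def)
  also have "(\<Oplus>k\<in>{..n}. [(n choose k)] \<cdot> f (Suc k)) \<oplus> ((\<Oplus>k\<in>{..n}. [(n choose Suc k)] \<cdot> f (Suc k)) \<oplus> f 0)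
     = (\<Oplus>k\<in>{..n}. [(Suc n choose Suc k)] \<cdot> f (Suc k)) \<oplus> f 0"
    by (subst a_assoc[symmetric]) (auto simp: f Pi_def add.nat_pow_mult[symmetric] intro!: arg_cong2[of _ _ _ _ "(\<oplus>)"] finsum_addf[symmetric])
  also have "\<dots> = (\<Oplus>k\<in>{..Suc n}. [(Suc n choose k)] \<cdot> f k)"
    by (subst finsum_Suc2) (auto simp: f Pi_def)
  finally show ?case by (simp only: f_def)
qed

text \<open>Only the two extreme terms survive, as \<open>p\<close> divides the other binomial coefficients.\<close>
lemma (in abelian_group) commuting_sum_funpow_prime:
  assumes A: "\<And>x. x \<in> carrier G \<Longrightarrow> A x \<in> carrier G"
    and B: "\<And>x. x \<in> carrier G \<Longrightarrow> B x \<in> carrier G"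
    and A_add: "\<And>x y. x \<in> carrier G \<Longrightarrow> y \<in> carrier G \<Longrightarrow> A (x \<oplus> y) = A x \<oplus> A y"
    and B_add: "\<And>x y. x \<in> carrier G \<Longrightarrow> y \<in> carrier G \<Longrightarrow> B (x \<oplus> y) = B x \<oplus> B y"
    and comm: "\<And>x. x \<in> carrier G \<Longrightarrow> A (B x) = B (A x)"
    and p: "Factorial_Ring.prime p"
    and torsion: "\<And>x. x \<in> carrier G \<Longrightarrow> [p] \<cdot> x = \<zero>"
    and x: "x \<in> carrier G"
  shows "((\<lambda>x. A x \<oplus> B x) ^^ p) x = (A ^^ p) x \<oplus> (B ^^ p) x"
proof -
  have Ak: "(A ^^ k) y \<in> carrier G" if "y \<in> carrier G" for y k
    using that A by (induction k) auto
  have Bk: "(B ^^ k) y \<in> carrier G" if "y \<in> carrier G" for y k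
    using that B by (induction k) auto
  define f where "f k = (A ^^ k) ((B ^^ (p - k)) x)" for k
  have f: "f k \<in> carrier G" for k by (simp add: f_def Ak Bk x)
  have mid: "[(p choose k)] \<cdot> f k = \<zero>" if "0 < k" "k < p" for k
  proof -
    have "p dvd (p choose k)"
      using dvd_choose_prime[of k p] that p by auto
    then obtain m where m: "p choose k = p * m" by (auto elim: dvdE)
    have "[(p choose k)] \<cdot> f k = [m] \<cdot> ([p] \<cdot> f k)"
      unfolding m using add.nat_pow_pow[OF f[of k], of m p] by (simp add: f mult.commute)
    then show ?thesis by (simp add: torsion f)
  qed
  \<comment> \<open>Writing \<open>p = q + 2\<close> makes room to split off the first and the last summand.\<close>
  obtain q where q: "p = Suc (Suc q)"
    using prime_ge_2_nat[OF p] by (metis add_2_eq_Suc le_Suc_ex)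
  have "((\<lambda>x. A x \<oplus> B x) ^^ p) x = (\<Oplus>k\<in>{..p}. [(p choose k)] \<cdot> f k)"
    unfolding f_def by (rule commuting_sum_funpow) (use assms in auto)
  also have "\<dots> = f p \<oplus> (\<Oplus>k\<in>{..Suc q}. [(p choose k)] \<cdot> f k)"
    unfolding q by (subst finsum_Suc) (auto simp: f Pi_def q[symmetric] simp del: binomial_Suc_Suc)
  also have "(\<Oplus>k\<in>{..Suc q}. [(p choose k)] \<cdot> f k) = (\<Oplus>k\<in>{..q}. [(p choose Suc k)] \<cdot> f (Suc k)) \<oplus> f 0"
    by (subst finsum_Suc2) (auto simp: f Pi_def q)
  also have "(\<Oplus>k\<in>{..q}. [(p choose Suc k)] \<cdot> f (Suc k)) = \<zero>"
    by (rule add.finprod_one_eqI) (use mid q in \<open>auto simp del: binomial_Suc_Suc\<close>)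
  finally show ?thesis
    by (simp add: f) (simp add: f_def)
qed

lemma (in ring) torsion_if_torsion_one:
  assumes "[(n::nat)] \<cdot> \<one> = \<zero>" "x \<in> carrier R"
  shows "[n] \<cdot> x = \<zero>"
  using add_pow_ldistr[of \<one> x n] assms by simp

lemma (in monoid) pow_comm_self: "x \<in> carrier G \<Longrightarrow> x \<otimes> x [^] (n::nat) = x [^] n \<otimes> x"
  by (metis nat_pow_Suc nat_pow_Suc2)

text \<open>Apply the operator identity to the left multiplications by \<open>a\<close> and \<open>b\<close>, evaluated at \<open>1\<close>.\<close>
lemma (in ring) frobenius_add:
  assumes p: "Factorial_Ring.prime (p::nat)" and torsion: "[p] \<cdot> \<one> = \<zero>"
    and a: "a \<in> carrier R" and b: "b \<in> carrier R" and comm: "a \<otimes> b = b \<otimes> a"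
  shows "(a \<oplus> b) [^] p = a [^] p \<oplus> b [^] p"
proof -
  have pow: "((\<otimes>) c ^^ n) \<one> = c [^] n" if c: "c \<in> carrier R" for c and n :: nat
    by (induction n) (simp_all add: c pow_comm_self)
  have "((\<lambda>x. a \<otimes> x \<oplus> b \<otimes> x) ^^ p) \<one> = ((\<otimes>) a ^^ p) \<one> \<oplus> ((\<otimes>) b ^^ p) \<one>"
    by (rule commuting_sum_funpow_prime)
       (use a b comm p torsion in \<open>auto simp: r_distr torsion_if_torsion_one m_assoc[symmetric]\<close>)
  moreover have "((\<lambda>x. a \<otimes> x \<oplus> b \<otimes> x) ^^ p) \<one> = ((\<otimes>) (a \<oplus> b) ^^ p) \<one>"
  proof -
    have "((\<lambda>x. a \<otimes> x \<oplus> b \<otimes> x) ^^ n) \<one> = ((\<otimes>) (a \<oplus> b) ^^ n) \<one>" for n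
      by (induction n) (auto simp: pow a b l_distr)
    then show ?thesis .
  qed
  ultimately show ?thesis by (simp add: pow a b)
qed

lemma (in ring) frobenius_add_iterated:
  assumes p: "Factorial_Ring.prime (p::nat)" and torsion: "[p] \<cdot> \<one> = \<zero>"
    and a: "a \<in> carrier R" and b: "b \<in> carrier R" and comm: "a \<otimes> b = b \<otimes> a"
  shows "(a \<oplus> b) [^] (p ^ n) = a [^] (p ^ n) \<oplus> b [^] (p ^ n)"
proof (induction n)
  case (Suc n)
  have comm': "a [^] (p ^ n) \<otimes> b [^] (p ^ n) = b [^] (p ^ n) \<otimes> a [^] (p ^ n)"
    by (metis a b comm group_commutes_pow nat_pow_closed)
  have "(a \<oplus> b) [^] (p ^ Suc n) = ((a \<oplus> b) [^] (p ^ n)) [^] p"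
    by (simp add: nat_pow_pow a b mult.commute)
  also have "\<dots> = (a [^] (p ^ n)) [^] p \<oplus> (b [^] (p ^ n)) [^] p"
    unfolding Suc by (rule frobenius_add) (use p torsion a b comm' in auto)
  finally show ?case by (simp add: nat_pow_pow a b mult.commute)
qed (simp_all add: a b)

text \<open>
  Left multiplication by \<open>u\<close> is the sum of \<open>ad u\<close> and right multiplication by \<open>u\<close>, and these two
  commute. So \<open>u\<^sup>p y = (ad u)\<^sup>p y + y u\<^sup>p\<close>.
\<close>
lemma (in ring) prime_power_commutes_if_ad_nilpotent:
  assumes p: "Factorial_Ring.prime (p::nat)" and torsion: "[p] \<cdot> \<one> = \<zero>"
    and u: "u \<in> carrier R" and y: "y \<in> carrier R"
    and nil: "((\<lambda>x. u \<otimes> x \<ominus> x \<otimes> u) ^^ p) y = \<zero>"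
  shows "u [^] p \<otimes> y = y \<otimes> u [^] p"
proof -
  define D where "D = (\<lambda>x. u \<otimes> x \<ominus> x \<otimes> u)"
  define B where "B = (\<lambda>x. x \<otimes> u)"
  have D: "D x \<in> carrier R" if "x \<in> carrier R" for x using that u by (simp add: D_def)
  have left: "((\<lambda>x. D x \<oplus> B x) ^^ n) y = u [^] n \<otimes> y" for n
  proof (induction n)
    case (Suc n)
    have "D x \<oplus> B x = u \<otimes> x" if "x \<in> carrier R" for x
      using that u by (simp add: D_def B_def minus_eq a_assoc l_neg)
    then show ?case
      using Suc u y by (simp add: m_assoc[symmetric] pow_comm_self)
  qed (use y in simp)
  have right: "(B ^^ n) y = y \<otimes> u [^] n" for n
    by (induction n) (auto simp: B_def u y m_assoc)
  have "((\<lambda>x. D x \<oplus> B x) ^^ p) y = (D ^^ p) y \<oplus> (B ^^ p) y"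
  proof (rule commuting_sum_funpow_prime[OF D])
    fix x x' assume x: "x \<in> carrier R" "x' \<in> carrier R"
    show "D (x \<oplus> x') = D x \<oplus> D x'"
      using x u by (simp add: D_def minus_eq l_distr r_distr minus_add a_ac)
    show "B (x \<oplus> x') = B x \<oplus> B x'" "B x \<in> carrier R"
      using x u by (simp_all add: B_def l_distr)
    show "D (B x) = B (D x)"
      using x u by (simp add: B_def D_def minus_eq l_distr l_minus m_assoc)
  qed (use p torsion y torsion_if_torsion_one in auto)
  then show ?thesis using nil[folded D_def] u y by (simp add: left right)
qed

text \<open>
  The hypothesis \<open>rel\<close> says that \<open>c\<close> is the commutator of \<open>x\<close> and \<open>1 + w\<close>, in a form without
  inverses. The second conclusion is \<open>(s - 1)\<^sup>2 w = 0\<close>. It holds because conjugation by \<open>x\<close> multiplies \<open>w\<close>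
  by \<open>s\<close> and fixes \<open>c\<close>: so \<open>(1 + w) c = 1 + sw\<close> implies \<open>(1 + sw) c = 1 + s\<^sup>2w\<close>, and eliminating \<open>c\<close>
  leaves \<open>(1 + w)(1 + s\<^sup>2w) = (1 + sw)\<^sup>2\<close>.
\<close>
lemma (in ring) commuting_commutator_relation:
  assumes [simp]: "x \<in> carrier R" "x' \<in> carrier R" "w \<in> carrier R" "s \<in> carrier R" "c \<in> carrier R"
    and inv: "x \<otimes> x' = \<one>" and sx: "s \<otimes> x = x \<otimes> s" and sw: "s \<otimes> w = w \<otimes> s"
    and xw: "x \<otimes> w = s \<otimes> w \<otimes> x" and cx: "c \<otimes> x = x \<otimes> c"
    and rel: "(\<one> \<oplus> w) \<otimes> x \<otimes> c = x \<otimes> (\<one> \<oplus> w)"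
  shows "(\<one> \<oplus> w) \<otimes> c = \<one> \<oplus> s \<otimes> w" and "w \<oplus> s \<otimes> s \<otimes> w = s \<otimes> w \<oplus> s \<otimes> w"
proof -
  have cancel: "a = b" if "a \<otimes> x = b \<otimes> x" "a \<in> carrier R" "b \<in> carrier R" for a b
    using arg_cong[OF that(1), of "\<lambda>v. v \<otimes> x'"] that(2,3) by (simp add: m_assoc inv)
  have "(\<one> \<oplus> w) \<otimes> c \<otimes> x = (\<one> \<oplus> s \<otimes> w) \<otimes> x"
    using rel xw by (simp add: m_assoc cx l_distr r_distr)
  then show 1: "(\<one> \<oplus> w) \<otimes> c = \<one> \<oplus> s \<otimes> w" by (rule cancel) auto
  have xsw: "x \<otimes> (s \<otimes> w) = s \<otimes> s \<otimes> w \<otimes> x"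
  proof -
    have "x \<otimes> (s \<otimes> w) = s \<otimes> (x \<otimes> w)" by (simp add: m_assoc[symmetric] sx)
    then show ?thesis by (simp add: xw m_assoc)
  qed
  have "(\<one> \<oplus> s \<otimes> s \<otimes> w) \<otimes> x = x \<otimes> ((\<one> \<oplus> w) \<otimes> c)"
    unfolding 1 by (simp add: l_distr r_distr xsw)
  also have "\<dots> = (\<one> \<oplus> s \<otimes> w) \<otimes> c \<otimes> x"
  proof -
    have "x \<otimes> ((\<one> \<oplus> w) \<otimes> c) = (\<one> \<oplus> s \<otimes> w) \<otimes> x \<otimes> c"
      by (simp add: m_assoc[symmetric] l_distr r_distr xw)
    then show ?thesis by (simp add: m_assoc cx)
  qed
  finally have 2: "\<one> \<oplus> s \<otimes> s \<otimes> w = (\<one> \<oplus> s \<otimes> w) \<otimes> c" by (rule cancel) auto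
  have wsw: "w \<otimes> (s \<otimes> w) = s \<otimes> w \<otimes> w" by (metis sw m_assoc assms(3,4))
  have "(\<one> \<oplus> w) \<otimes> (\<one> \<oplus> s \<otimes> s \<otimes> w) = (\<one> \<oplus> w) \<otimes> (\<one> \<oplus> s \<otimes> w) \<otimes> c"
    unfolding 2 by (simp add: m_assoc)
  also have "(\<one> \<oplus> w) \<otimes> (\<one> \<oplus> s \<otimes> w) = (\<one> \<oplus> s \<otimes> w) \<otimes> (\<one> \<oplus> w)"
    by (simp add: l_distr r_distr wsw a_ac)
  also have "\<dots> \<otimes> c = (\<one> \<oplus> s \<otimes> w) \<otimes> (\<one> \<oplus> s \<otimes> w)"
    by (simp add: m_assoc 1)
  finally have "(\<one> \<oplus> w) \<otimes> (\<one> \<oplus> s \<otimes> s \<otimes> w) = (\<one> \<oplus> s \<otimes> w) \<otimes> (\<one> \<oplus> s \<otimes> w)" .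
  moreover have "w \<otimes> (s \<otimes> s \<otimes> w) = s \<otimes> w \<otimes> (s \<otimes> w)"
  proof -
    have "w \<otimes> (s \<otimes> s \<otimes> w) = (w \<otimes> s) \<otimes> (s \<otimes> w)" by (simp add: m_assoc)
    then show ?thesis by (simp add: sw)
  qed
  ultimately have "(w \<oplus> s \<otimes> s \<otimes> w) \<oplus> (\<one> \<oplus> s \<otimes> w \<otimes> (s \<otimes> w)) =
      (s \<otimes> w \<oplus> s \<otimes> w) \<oplus> (\<one> \<oplus> s \<otimes> w \<otimes> (s \<otimes> w))"
    by (simp add: l_distr r_distr a_ac)
  then show "w \<oplus> s \<otimes> s \<otimes> w = s \<otimes> w \<oplus> s \<otimes> w" by (subst (asm) add.r_cancel) auto
qed

lemma (in monoid) commutes_mult: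
  assumes "s \<in> carrier G" "s' \<in> carrier G" "x \<in> carrier G"
    and "s \<otimes> x = x \<otimes> s" "s' \<otimes> x = x \<otimes> s'"
  shows "(s \<otimes> s') \<otimes> x = x \<otimes> (s \<otimes> s')"
proof -
  have "(s \<otimes> s') \<otimes> x = (s \<otimes> x) \<otimes> s'" using assms(1-3,5) by (simp add: m_assoc)
  also have "\<dots> = (x \<otimes> s) \<otimes> s'" by (simp only: assms(4))
  also have "\<dots> = x \<otimes> (s \<otimes> s')" using assms(1-3) by (simp add: m_assoc)
  finally show ?thesis .
qed

lemma (in group) mult_commutator:
  assumes "x \<in> carrier G" "y \<in> carrier G"
  shows "y \<otimes> x \<otimes> commutator G x y = x \<otimes> y"
proof -
  have "a \<otimes> (inv a \<otimes> b) = b" if "a \<in> carrier G" "b \<in> carrier G" for a b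
    using that by (simp add: m_assoc[symmetric])
  then show ?thesis using assms by (simp add: commutator_def m_assoc)
qed

section \<open>Finite \<open>p\<close>-groups\<close>

text \<open>
  Cauchy's argument: a second prime \<open>q\<close> dividing the order would give, by Sylow's theorem with
  exponent one, a subgroup of order \<open>q\<close>, whose elements have orders dividing both \<open>q\<close> and a power of \<open>p\<close>.
\<close>
lemma (in group) prime_power_order_if_exponent:
  assumes p: "Factorial_Ring.prime (p::nat)" and fin: "finite (carrier G)"
    and exponent: "\<And>x. x \<in> carrier G \<Longrightarrow> x [^] (p ^ n) = \<one>"
  shows "\<exists>k. order G = p ^ k"
proof -
  have pos: "order G > 0" using fin by (simp add: order_gt_0_iff_finite)
  have only_p: "q = p" if q: "Factorial_Ring.prime q" "q dvd order G" for q
  proof (rule ccontr)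
    assume "q \<noteq> p"
    obtain m where "order G = q ^ 1 * m" using q by (auto elim: dvdE)
    from sylow_thm[OF q(1) is_group this fin] obtain H where H: "subgroup H G" "card H = q"
      by auto
    have "1 < card H" using H q prime_gt_1_nat by simp
    then obtain x where x: "x \<in> H" "x \<noteq> \<one>"
      by (metis One_nat_def card_le_Suc0_iff_eq fin finite_subset leD H(1) subgroup.subset subgroup.one_closed)
    have xG: "x \<in> carrier G" using x H subgroup.subset by auto
    interpret H: group "G\<lparr>carrier := H\<rparr>" using H(1) by (rule subgroup_imp_group)
    have "x [^] order (G\<lparr>carrier := H\<rparr>) = \<one>"
      using H.pow_order_eq_1[of x] x unfolding nat_pow_consistent[of x _ H] by simp
    then have "x [^] q = \<one>" using H by (simp add: order_def)
    then have "ord x dvd q" using xG by (simp add: pow_eq_id)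
    moreover have "ord x dvd p ^ n" using exponent[OF xG] xG by (simp add: pow_eq_id)
    moreover have "coprime q (p ^ n)"
      using primes_coprime[OF q(1) p \<open>q \<noteq> p\<close>] by simp
    ultimately have "ord x = 1" by (metis coprime_common_divisor_nat)
    then show False using x xG by (metis ord_eq_1)
  qed
  obtain m where m: "order G = p ^ multiplicity p (order G) * m" "\<not> p dvd m"
    by (rule multiplicity_decompose'[of "order G" p]) (use pos p in auto)
  have "m = 1"
  proof (rule ccontr)
    assume "m \<noteq> 1"
    then obtain q where "Factorial_Ring.prime q" "q dvd m" using prime_factor_nat by blast
    then show False using only_p m by (metis dvd_mult)
  qed
  then show ?thesis using m by auto
qed

text \<open>
  The class equation: conjugacy classes have \<open>p\<close>-power size, so if \<open>{1}\<close> were the only class with one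
  element, the order of the group would be congruent to \<open>1\<close> modulo \<open>p\<close>.
\<close>
lemma (in group) p_group_center_nontrivial:
  assumes p: "Factorial_Ring.prime (p::nat)" and order: "order G = p ^ n" and "order G > 1"
  obtains z where "z \<in> carrier G" "z \<noteq> \<one>" "\<And>x. x \<in> carrier G \<Longrightarrow> x \<otimes> z = z \<otimes> x"
proof -
  define conj where "conj = (\<lambda>g. (\<lambda>h \<in> carrier G. g \<otimes> h \<otimes> (inv g)))"
  interpret group_action G "carrier G" conj
    unfolding conj_def by (rule action_by_conjugation)
  have fin: "finite (carrier G)" using assms order_gt_0_iff_finite by fastforce
  define Orb where "Orb = orbits G (carrier G) conj"
  have orbit_one: "orbit G conj \<one> = {\<one>}"
    by (auto simp: orbit_def conj_def intro!: exI[of _ \<one>])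
  have disj: "A = B" if "A \<in> Orb" "B \<in> Orb" "x \<in> A" "x \<in> B" for A B x
    using disjoint_union[of A B] that unfolding Orb_def by auto
  have Un: "\<Union>Orb = carrier G" unfolding Orb_def by (rule orbits_coverture)
  then have finO: "finite Orb" using fin by (metis finite_UnionD)
  have one_in: "{\<one>} \<in> Orb" unfolding Orb_def orbits_def using orbit_one by auto
  have "\<exists>z\<in>carrier G. z \<noteq> \<one> \<and> orbit G conj z = {z}"
  proof (rule ccontr)
    assume *: "\<not> ?thesis"
    have dvd: "p dvd card A" if A: "A \<in> Orb - {{\<one>}}" for A
    proof -
      obtain x where x: "x \<in> carrier G" "A = orbit G conj x"
        using A by (auto simp: Orb_def orbits_def)
      have "x \<in> A" using x orbit_refl by simp
      have "card A dvd p ^ n"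
        using orbit_stabilizer_theorem[OF x(1)] x order by (metis dvd_triv_left)
      moreover have "card A \<noteq> 1"
        using * x orbit_one A \<open>x \<in> A\<close> by (metis DiffD2 card_1_singletonE singletonD singletonI)
      ultimately show ?thesis
        using p by (metis divides_primepow_nat dvd_refl dvd_power gr_zeroI power_0)
    qed
    have "card (\<Union>Orb) = (\<Sum>A\<in>Orb. card A)"
      by (rule card_Union_disjoint)
        (use disj fin Un in \<open>auto simp: pairwise_def disjnt_def intro: finite_subset\<close>)
    also have "\<dots> = 1 + (\<Sum>A\<in>Orb - {{\<one>}}. card A)"
      by (subst sum.remove[OF finO one_in]) simp
    finally have "order G = 1 + (\<Sum>A\<in>Orb - {{\<one>}}. card A)" using Un by (simp add: order_def)
    moreover have "p dvd (\<Sum>A\<in>Orb - {{\<one>}}. card A)" by (rule dvd_sum) (rule dvd)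
    moreover have "p dvd order G" using order \<open>order G > 1\<close> by (cases n) auto
    ultimately have "p dvd 1" by (metis dvd_add_left_iff)
    then show False using p by auto
  qed
  then obtain z where z: "z \<in> carrier G" "z \<noteq> \<one>" "orbit G conj z = {z}" by blast
  have "x \<otimes> z = z \<otimes> x" if x: "x \<in> carrier G" for x
  proof -
    have "x \<otimes> z \<otimes> inv x \<in> orbit G conj z"
      using x z unfolding orbit_def conj_def by auto
    then have "x \<otimes> z \<otimes> inv x = z" using z by simp
    then show ?thesis using x z by (metis inv_solve_right' m_closed)
  qed
  then show ?thesis using z that by blast
qed

lemma (in group) p_group_central_prime_order:
  assumes p: "Factorial_Ring.prime (p::nat)" and order: "order G = p ^ n" and gt: "order G > 1"
  obtains z where "z \<in> carrier G" "z \<noteq> \<one>" "z [^] p = \<one>"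
    "\<And>x. x \<in> carrier G \<Longrightarrow> x \<otimes> z = z \<otimes> x"
proof -
  from p_group_center_nontrivial[OF assms] obtain c where
    c: "c \<in> carrier G" "c \<noteq> \<one>" "\<And>x. x \<in> carrier G \<Longrightarrow> x \<otimes> c = c \<otimes> x" by blast
  define k where "k = (LEAST k. c [^] (p ^ k) = \<one>)"
  have "c [^] (p ^ n) = \<one>" using pow_order_eq_1[OF c(1)] order by simp
  then have k: "c [^] (p ^ k) = \<one>" unfolding k_def by (rule LeastI)
  then obtain j where j: "k = Suc j" using c by (cases k) auto
  have "c [^] (p ^ j) \<noteq> \<one>" using not_less_Least[of j "\<lambda>k. c [^] (p ^ k) = \<one>"] j k_def by auto
  moreover have "(c [^] (p ^ j)) [^] p = \<one>" using k j c by (simp add: nat_pow_pow mult.commute)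
  moreover have "x \<otimes> c [^] (p ^ j) = c [^] (p ^ j) \<otimes> x" if "x \<in> carrier G" for x
    using that c group_commutes_pow by metis
  ultimately show ?thesis using that[of "c [^] (p ^ j)"] c by simp
qed

text \<open>
  Take \<open>N\<close> maximal among the normal subgroups with nonabelian quotient \<open>H\<close>, and a central element
  \<open>z\<close> of order \<open>p\<close> in \<open>H\<close>. The preimage \<open>M\<close> of \<open>\<langle>z\<rangle>\<close> in \<open>G\<close> is normal and properly contains \<open>N\<close>, so
  \<open>G/M\<close> is abelian, which means that the commutators of \<open>H\<close> lie in \<open>\<langle>z\<rangle>\<close>. Choosing \<open>N\<close> inside \<open>G\<close>,
  instead of arguing by induction on the order, keeps everything within a single type of elements.
\<close>
lemma nonabelian_p_group_minimal_quotient: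
  assumes p: "Factorial_Ring.prime (p::nat)" and G: "finite_p_group p G" and nonab: "\<not> comm_group G"
  obtains N z where "N \<lhd> G" "z \<in> carrier (G Mod N)" "z \<noteq> \<one>\<^bsub>G Mod N\<^esub>"
    "z [^]\<^bsub>G Mod N\<^esub> p = \<one>\<^bsub>G Mod N\<^esub>"
    "\<And>x. x \<in> carrier (G Mod N) \<Longrightarrow> x \<otimes>\<^bsub>G Mod N\<^esub> z = z \<otimes>\<^bsub>G Mod N\<^esub> x"
    "\<And>x y. x \<in> carrier (G Mod N) \<Longrightarrow> y \<in> carrier (G Mod N) \<Longrightarrow>
      \<exists>i::nat. x \<otimes>\<^bsub>G Mod N\<^esub> y = z [^]\<^bsub>G Mod N\<^esub> i \<otimes>\<^bsub>G Mod N\<^esub> (y \<otimes>\<^bsub>G Mod N\<^esub> x)"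
    "\<exists>x\<in>carrier (G Mod N). \<exists>y\<in>carrier (G Mod N). x \<otimes>\<^bsub>G Mod N\<^esub> y \<noteq> y \<otimes>\<^bsub>G Mod N\<^esub> x"
proof -
  interpret G: group G using G by (simp add: finite_p_group_def)
  have fin: "finite (carrier G)" using G by (simp add: finite_p_group_def)
  obtain n where order: "order G = p ^ n" using G by (auto simp: finite_p_group_def)
  define \<N> where "\<N> = {N. N \<lhd> G \<and> (\<exists>x\<in>carrier G. \<exists>y\<in>carrier G.
    N #>\<^bsub>G\<^esub> (x \<otimes>\<^bsub>G\<^esub> y) \<noteq> N #>\<^bsub>G\<^esub> (y \<otimes>\<^bsub>G\<^esub> x))}"
  have "\<exists>x\<in>carrier G. \<exists>y\<in>carrier G. x \<otimes>\<^bsub>G\<^esub> y \<noteq> y \<otimes>\<^bsub>G\<^esub> x"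
    using nonab G.group_comm_groupI by blast
  then have "{\<one>\<^bsub>G\<^esub>} \<in> \<N>"
    unfolding \<N>_def using G.one_is_normal by (auto simp: r_coset_def)
  moreover have "finite \<N>"
    by (rule finite_subset[of _ "Pow (carrier G)"])
      (use fin normal_imp_subgroup subgroup.subset in \<open>fastforce simp: \<N>_def\<close>)+
  ultimately have "Max (card ` \<N>) \<in> card ` \<N>" "finite (card ` \<N>)" by (auto intro!: Max_in)
  then obtain N where N: "N \<in> \<N>" "card N = Max (card ` \<N>)" by (auto elim!: imageE)
  have max: "card M \<le> card N" if "M \<in> \<N>" for M
    unfolding N(2) using \<open>finite \<N>\<close> that by simp
  have "N \<lhd> G" using N(1) by (simp add: \<N>_def)
  then interpret N: normal N G .
  define H where "H = G Mod N"
  interpret H: group H unfolding H_def by (rule N.factorgroup_is_group)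
  define \<phi> where "\<phi> x = N #>\<^bsub>G\<^esub> x" for x
  have hom: "\<phi> (x \<otimes>\<^bsub>G\<^esub> y) = \<phi> x \<otimes>\<^bsub>H\<^esub> \<phi> y" if "x \<in> carrier G" "y \<in> carrier G" for x y
    using that by (simp add: \<phi>_def H_def N.rcos_sum)
  have carrier_H: "carrier H = \<phi> ` carrier G"
    by (simp add: H_def \<phi>_def carrier_FactGroup)
  have closed [simp]: "\<phi> x \<in> carrier H" if "x \<in> carrier G" for x using that carrier_H by simp
  have one_H: "\<one>\<^bsub>H\<^esub> = N" by (simp add: H_def)
  have ker: "\<phi> x = \<one>\<^bsub>H\<^esub> \<longleftrightarrow> x \<in> N" if "x \<in> carrier G" for x
    unfolding \<phi>_def one_H using that
    by (metis G.coset_join1 G.coset_join2 N.subgroup_axioms N.subset)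
  have \<phi>_one [simp]: "\<phi> \<one>\<^bsub>G\<^esub> = \<one>\<^bsub>H\<^esub>" using ker[of "\<one>\<^bsub>G\<^esub>"] N.one_closed by simp
  have \<phi>_inv: "\<phi> (inv\<^bsub>G\<^esub> x) = inv\<^bsub>H\<^esub> \<phi> x" if "x \<in> carrier G" for x
    using that hom[of "inv\<^bsub>G\<^esub> x" x] by (simp add: H.inv_equality)
  have nonabH: "\<exists>x\<in>carrier H. \<exists>y\<in>carrier H. x \<otimes>\<^bsub>H\<^esub> y \<noteq> y \<otimes>\<^bsub>H\<^esub> x"
    using N(1) hom unfolding \<N>_def carrier_H by (auto simp: \<phi>_def)
  have finH: "finite (carrier H)" using fin carrier_H by simp
  have "order H dvd p ^ n"
    using G.lagrange[OF N.subgroup_axioms] order unfolding H_def order_def FactGroup_def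
    by (simp) (metis dvd_triv_left)
  then obtain m where m: "order H = p ^ m" using p divides_primepow_nat by blast
  have "order H > 1"
  proof (rule ccontr)
    assume "\<not> order H > 1"
    then have "card (carrier H) \<le> Suc 0" by (simp add: order_def)
    then show False using nonabH finH by (metis H.m_closed card_le_Suc0_iff_eq)
  qed
  with H.p_group_central_prime_order[OF p m] obtain z where
    z: "z \<in> carrier H" "z \<noteq> \<one>\<^bsub>H\<^esub>" "z [^]\<^bsub>H\<^esub> p = \<one>\<^bsub>H\<^esub>"
      "\<And>x. x \<in> carrier H \<Longrightarrow> x \<otimes>\<^bsub>H\<^esub> z = z \<otimes>\<^bsub>H\<^esub> x" by blast
  have z_pow: "x \<otimes>\<^bsub>H\<^esub> z [^]\<^bsub>H\<^esub> (i::nat) = z [^]\<^bsub>H\<^esub> i \<otimes>\<^bsub>H\<^esub> x" if "x \<in> carrier H" for x i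
    using that z H.group_commutes_pow by metis
  define M where "M = {x \<in> carrier G. \<exists>i::nat. \<phi> x = z [^]\<^bsub>H\<^esub> i}"
  have "subgroup M G"
  proof (rule G.subgroupI)
    show "M \<noteq> {}" unfolding M_def using H.nat_pow_0 \<phi>_one by (metis (mono_tags, lifting) G.one_closed empty_iff mem_Collect_eq)
    fix a assume a: "a \<in> M"
    then obtain i :: nat where i: "a \<in> carrier G" "\<phi> a = z [^]\<^bsub>H\<^esub> i" by (auto simp: M_def)
    \<comment> \<open>The inverse of \<open>z\<^sup>i\<close> as a power with exponent in the natural numbers.\<close>
    have "(p - 1) * i + i = p * i" using prime_gt_0_nat[OF p] by (cases p) auto
    then have "z [^]\<^bsub>H\<^esub> ((p - 1) * i) \<otimes>\<^bsub>H\<^esub> z [^]\<^bsub>H\<^esub> i = (z [^]\<^bsub>H\<^esub> p) [^]\<^bsub>H\<^esub> i"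
      using z(1) by (simp only: H.nat_pow_mult H.nat_pow_pow)
    also have "\<dots> = \<one>\<^bsub>H\<^esub>" using z(3) by simp
    finally have "z [^]\<^bsub>H\<^esub> ((p - 1) * i) \<otimes>\<^bsub>H\<^esub> z [^]\<^bsub>H\<^esub> i = \<one>\<^bsub>H\<^esub>" .
    then have "inv\<^bsub>H\<^esub> (z [^]\<^bsub>H\<^esub> i) = z [^]\<^bsub>H\<^esub> ((p - 1) * i)"
      using z by (intro H.inv_equality) auto
    then show "inv\<^bsub>G\<^esub> a \<in> M" using i by (auto simp: M_def \<phi>_inv)
    fix b assume b: "b \<in> M"
    then obtain j :: nat where j: "b \<in> carrier G" "\<phi> b = z [^]\<^bsub>H\<^esub> j" by (auto simp: M_def)
    then show "a \<otimes>\<^bsub>G\<^esub> b \<in> M" using i z by (auto simp: M_def hom H.nat_pow_mult)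
  qed (auto simp: M_def)
  moreover have "x \<otimes>\<^bsub>G\<^esub> a \<otimes>\<^bsub>G\<^esub> inv\<^bsub>G\<^esub> x \<in> M" if x: "x \<in> carrier G" and a: "a \<in> M" for x a
  proof -
    from a obtain i :: nat where i: "a \<in> carrier G" "\<phi> a = z [^]\<^bsub>H\<^esub> i" by (auto simp: M_def)
    have "\<phi> (x \<otimes>\<^bsub>G\<^esub> a \<otimes>\<^bsub>G\<^esub> inv\<^bsub>G\<^esub> x) = z [^]\<^bsub>H\<^esub> i"
      using x i z by (simp add: hom \<phi>_inv z_pow H.m_assoc)
    then show ?thesis using x i by (auto simp: M_def)
  qed
  ultimately have "M \<lhd> G" by (auto simp: G.normal_inv_iff)
  have "N \<subset> M"
  proof
    show "N \<subseteq> M"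
    proof
      fix x assume x: "x \<in> N"
      then have xG: "x \<in> carrier G" using N.subset by auto
      then have "\<phi> x = z [^]\<^bsub>H\<^esub> (0::nat)" using ker x by simp
      then show "x \<in> M" using xG unfolding M_def by blast
    qed
    obtain a where a: "a \<in> carrier G" "\<phi> a = z" using z(1) carrier_H by auto
    have "\<phi> a = z [^]\<^bsub>H\<^esub> (1::nat)" using a z(1) by simp
    then have "a \<in> M" using a(1) unfolding M_def by blast
    moreover have "a \<notin> N" using ker[OF a(1)] a(2) z(2) by simp
    ultimately show "N \<noteq> M" by auto
  qed
  moreover have "finite M" using fin by (auto simp: M_def)
  ultimately have "card N < card M" by (metis psubset_card_mono)
  then have "M \<notin> \<N>" using max by (meson leD)
  then have ab: "M #>\<^bsub>G\<^esub> (x \<otimes>\<^bsub>G\<^esub> y) = M #>\<^bsub>G\<^esub> (y \<otimes>\<^bsub>G\<^esub> x)"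
    if "x \<in> carrier G" "y \<in> carrier G" for x y
    using \<open>M \<lhd> G\<close> that by (auto simp: \<N>_def)
  have comm: "\<exists>i::nat. x \<otimes>\<^bsub>H\<^esub> y = z [^]\<^bsub>H\<^esub> i \<otimes>\<^bsub>H\<^esub> (y \<otimes>\<^bsub>H\<^esub> x)"
    if xy: "x \<in> carrier H" "y \<in> carrier H" for x y
  proof -
    obtain a b where ab': "a \<in> carrier G" "b \<in> carrier G" "x = \<phi> a" "y = \<phi> b"
      using xy carrier_H by auto
    have "a \<otimes>\<^bsub>G\<^esub> b \<in> M #>\<^bsub>G\<^esub> (a \<otimes>\<^bsub>G\<^esub> b)"
      using \<open>subgroup M G\<close> ab' by (simp add: G.rcos_self)
    then obtain m where m: "m \<in> M" "a \<otimes>\<^bsub>G\<^esub> b = m \<otimes>\<^bsub>G\<^esub> (b \<otimes>\<^bsub>G\<^esub> a)"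
      using ab[OF ab'(1,2)] by (auto simp: r_coset_def)
    then obtain i :: nat where i: "m \<in> carrier G" "\<phi> m = z [^]\<^bsub>H\<^esub> i" by (auto simp: M_def)
    have "x \<otimes>\<^bsub>H\<^esub> y = \<phi> (m \<otimes>\<^bsub>G\<^esub> (b \<otimes>\<^bsub>G\<^esub> a))"
      using ab' by (simp add: hom[symmetric] m(2))
    also have "\<dots> = z [^]\<^bsub>H\<^esub> i \<otimes>\<^bsub>H\<^esub> (y \<otimes>\<^bsub>H\<^esub> x)"
      using ab' i by (simp add: hom)
    finally show ?thesis by blast
  qed
  show ?thesis
    by (rule that[OF \<open>N \<lhd> G\<close>, folded H_def, OF z(1,2,3) z(4) comm nonabH]) 
qed

section \<open>The group ring of a finite group\<close>

lemma (in abelian_monoid) finsum_swap: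
  assumes "finite A" "finite B" "\<And>a b. a \<in> A \<Longrightarrow> b \<in> B \<Longrightarrow> f a b \<in> carrier G"
  shows "(\<Oplus>a\<in>A. \<Oplus>b\<in>B. f a b) = (\<Oplus>b\<in>B. \<Oplus>a\<in>A. f a b)"
  using assms(1,3)
proof (induction A rule: finite_induct)
  case empty
  then show ?case by simp
next
  case (insert x A)
  have "(\<Oplus>a\<in>insert x A. \<Oplus>b\<in>B. f a b) = (\<Oplus>b\<in>B. f x b) \<oplus> (\<Oplus>b\<in>B. \<Oplus>a\<in>A. f a b)"
    using insert by (subst finsum_insert) (auto intro!: finsum_closed)
  also have "\<dots> = (\<Oplus>b\<in>B. f x b \<oplus> (\<Oplus>a\<in>A. f a b))"
    using insert by (subst finsum_addf) (auto intro!: finsum_closed)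
  also have "\<dots> = (\<Oplus>b\<in>B. \<Oplus>a\<in>insert x A. f a b)"
    using insert by (intro finsum_cong') (auto intro!: finsum_closed)
  finally show ?case .
qed

locale group_ring = F: cring F + G: group G
  for F :: "('f, 'r) ring_scheme" and G :: "('g, 'm) monoid_scheme" +
  assumes finite_group: "finite (carrier G)"
begin

abbreviation R :: "('g \<Rightarrow> 'f) ring" where "R \<equiv> group_algebra F G"

definition single :: "'f \<Rightarrow> 'g \<Rightarrow> 'g \<Rightarrow> 'f" where
  "single \<alpha> x = (\<lambda>g\<in>carrier G. if g = x then \<alpha> else \<zero>\<^bsub>F\<^esub>)"

lemma carrier_R: "carrier R = carrier G \<rightarrow>\<^sub>E carrier F"
  by (simp add: group_algebra_def)

lemma coeff_closed [simp, intro]: "u \<in> carrier R \<Longrightarrow> g \<in> carrier G \<Longrightarrow> u g \<in> carrier F"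
  by (auto simp: carrier_R)

lemma group_ring_eqI:
  assumes "u \<in> carrier R" "v \<in> carrier R" "\<And>g. g \<in> carrier G \<Longrightarrow> u g = v g"
  shows "u = v"
  using assms by (auto simp: carrier_R intro: PiE_ext)

lemma add_apply [simp]: "g \<in> carrier G \<Longrightarrow> (u \<oplus>\<^bsub>R\<^esub> v) g = u g \<oplus>\<^bsub>F\<^esub> v g"
  and zero_apply [simp]: "g \<in> carrier G \<Longrightarrow> \<zero>\<^bsub>R\<^esub> g = \<zero>\<^bsub>F\<^esub>"
  and mult_apply: "g \<in> carrier G \<Longrightarrow>
    (u \<otimes>\<^bsub>R\<^esub> v) g = (\<Oplus>\<^bsub>F\<^esub>h\<in>carrier G. u h \<otimes>\<^bsub>F\<^esub> v (inv\<^bsub>G\<^esub> h \<otimes>\<^bsub>G\<^esub> g))"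
  and single_apply [simp]: "g \<in> carrier G \<Longrightarrow> single \<alpha> x g = (if g = x then \<alpha> else \<zero>\<^bsub>F\<^esub>)"
  and one_eq_single: "\<one>\<^bsub>R\<^esub> = single \<one>\<^bsub>F\<^esub> \<one>\<^bsub>G\<^esub>"
  by (auto simp: group_algebra_def single_def)

lemma add_closed': "u \<in> carrier R \<Longrightarrow> v \<in> carrier R \<Longrightarrow> u \<oplus>\<^bsub>R\<^esub> v \<in> carrier R"
  and mult_closed': "u \<in> carrier R \<Longrightarrow> v \<in> carrier R \<Longrightarrow> u \<otimes>\<^bsub>R\<^esub> v \<in> carrier R"
  and zero_closed': "\<zero>\<^bsub>R\<^esub> \<in> carrier R"
  and single_closed [simp, intro]: "\<alpha> \<in> carrier F \<Longrightarrow> single \<alpha> x \<in> carrier R"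
  by (auto simp: group_algebra_def single_def PiE_mem intro!: F.finsum_closed F.m_closed)

text \<open>
  Extending \<open>f\<close> linearly to \<open>FG\<close>, this computes the value at a product \<open>uv\<close>. It reduces associativity
  and the multiplicativity of the augmentation to rearranging a double sum, by choosing \<open>f\<close> suitably.
\<close>
lemma sum_mult_pairing:
  assumes u: "u \<in> carrier R" and v: "v \<in> carrier R" and f: "f \<in> carrier G \<rightarrow> carrier F"
  shows "(\<Oplus>\<^bsub>F\<^esub>g\<in>carrier G. (u \<otimes>\<^bsub>R\<^esub> v) g \<otimes>\<^bsub>F\<^esub> f g) =
    (\<Oplus>\<^bsub>F\<^esub>h\<in>carrier G. \<Oplus>\<^bsub>F\<^esub>k\<in>carrier G. u h \<otimes>\<^bsub>F\<^esub> v k \<otimes>\<^bsub>F\<^esub> f (h \<otimes>\<^bsub>G\<^esub> k))"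
proof -
  have f': "f g \<in> carrier F" if "g \<in> carrier G" for g using f that by auto
  have "(\<Oplus>\<^bsub>F\<^esub>g\<in>carrier G. (u \<otimes>\<^bsub>R\<^esub> v) g \<otimes>\<^bsub>F\<^esub> f g) =
    (\<Oplus>\<^bsub>F\<^esub>g\<in>carrier G. \<Oplus>\<^bsub>F\<^esub>h\<in>carrier G. u h \<otimes>\<^bsub>F\<^esub> v (inv\<^bsub>G\<^esub> h \<otimes>\<^bsub>G\<^esub> g) \<otimes>\<^bsub>F\<^esub> f g)"
    by (intro F.finsum_cong')
      (auto simp: mult_apply u v f' finite_group intro!: F.finsum_closed F.finsum_ldistr)
  also have "\<dots> = (\<Oplus>\<^bsub>F\<^esub>h\<in>carrier G. \<Oplus>\<^bsub>F\<^esub>g\<in>carrier G. u h \<otimes>\<^bsub>F\<^esub> v (inv\<^bsub>G\<^esub> h \<otimes>\<^bsub>G\<^esub> g) \<otimes>\<^bsub>F\<^esub> f g)"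
    by (rule F.finsum_swap) (auto simp: u v f' finite_group)
  also have "\<dots> = (\<Oplus>\<^bsub>F\<^esub>h\<in>carrier G. \<Oplus>\<^bsub>F\<^esub>k\<in>carrier G. u h \<otimes>\<^bsub>F\<^esub> v k \<otimes>\<^bsub>F\<^esub> f (h \<otimes>\<^bsub>G\<^esub> k))"
  proof (rule F.finsum_cong')
    fix h assume h: "h \<in> carrier G"
    have im: "(\<lambda>k. h \<otimes>\<^bsub>G\<^esub> k) ` carrier G = carrier G"
      by (simp add: h G.surj_const_mult)
    have inj: "inj_on (\<lambda>k. h \<otimes>\<^bsub>G\<^esub> k) (carrier G)"
      by (simp add: h G.inj_on_cmult)
    let ?t = "\<lambda>g. u h \<otimes>\<^bsub>F\<^esub> v (inv\<^bsub>G\<^esub> h \<otimes>\<^bsub>G\<^esub> g) \<otimes>\<^bsub>F\<^esub> f g"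
    have "(\<Oplus>\<^bsub>F\<^esub>g\<in>carrier G. ?t g) = (\<Oplus>\<^bsub>F\<^esub>g\<in>(\<lambda>k. h \<otimes>\<^bsub>G\<^esub> k) ` carrier G. ?t g)"
      by (simp only: im)
    also have "\<dots> = (\<Oplus>\<^bsub>F\<^esub>k\<in>carrier G. ?t (h \<otimes>\<^bsub>G\<^esub> k))"
      by (rule F.finsum_reindex[OF _ inj]) (auto simp: h u v f')
    also have "\<dots> = (\<Oplus>\<^bsub>F\<^esub>k\<in>carrier G. u h \<otimes>\<^bsub>F\<^esub> v k \<otimes>\<^bsub>F\<^esub> f (h \<otimes>\<^bsub>G\<^esub> k))"
      by (intro F.finsum_cong') (auto simp: h u v f' G.m_assoc[symmetric])
    finally show "(\<Oplus>\<^bsub>F\<^esub>g\<in>carrier G. ?t g) = (\<Oplus>\<^bsub>F\<^esub>k\<in>carrier G. u h \<otimes>\<^bsub>F\<^esub> v k \<otimes>\<^bsub>F\<^esub> f (h \<otimes>\<^bsub>G\<^esub> k))" .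
  qed (auto simp: u v f' intro!: F.finsum_closed)
  finally show ?thesis .
qed

lemma mult_assoc':
  assumes u: "u \<in> carrier R" and v: "v \<in> carrier R" and w: "w \<in> carrier R"
  shows "(u \<otimes>\<^bsub>R\<^esub> v) \<otimes>\<^bsub>R\<^esub> w = u \<otimes>\<^bsub>R\<^esub> (v \<otimes>\<^bsub>R\<^esub> w)"
proof (rule group_ring_eqI)
  fix g assume g: "g \<in> carrier G"
  have "((u \<otimes>\<^bsub>R\<^esub> v) \<otimes>\<^bsub>R\<^esub> w) g = (\<Oplus>\<^bsub>F\<^esub>a\<in>carrier G. \<Oplus>\<^bsub>F\<^esub>b\<in>carrier G.
      u a \<otimes>\<^bsub>F\<^esub> v b \<otimes>\<^bsub>F\<^esub> w (inv\<^bsub>G\<^esub> (a \<otimes>\<^bsub>G\<^esub> b) \<otimes>\<^bsub>G\<^esub> g))"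
    unfolding mult_apply[OF g, of "u \<otimes>\<^bsub>R\<^esub> v"]
    by (rule sum_mult_pairing) (auto simp: u v w g)
  also have "\<dots> = (\<Oplus>\<^bsub>F\<^esub>a\<in>carrier G. u a \<otimes>\<^bsub>F\<^esub> (v \<otimes>\<^bsub>R\<^esub> w) (inv\<^bsub>G\<^esub> a \<otimes>\<^bsub>G\<^esub> g))"
    by (intro F.finsum_cong')
       (auto simp: u v w g mult_apply G.m_assoc[symmetric] G.inv_mult_group finite_group F.finsum_rdistr
         F.m_assoc[symmetric] intro!: F.finsum_cong' F.finsum_closed F.m_closed)
  finally show "((u \<otimes>\<^bsub>R\<^esub> v) \<otimes>\<^bsub>R\<^esub> w) g = (u \<otimes>\<^bsub>R\<^esub> (v \<otimes>\<^bsub>R\<^esub> w)) g"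
    by (simp add: mult_apply[OF g, of u])
qed (auto simp: u v w intro!: mult_closed')

lemma single_mult_apply:
  assumes [simp]: "\<alpha> \<in> carrier F" "x \<in> carrier G" "u \<in> carrier R" "g \<in> carrier G"
  shows "(single \<alpha> x \<otimes>\<^bsub>R\<^esub> u) g = \<alpha> \<otimes>\<^bsub>F\<^esub> u (inv\<^bsub>G\<^esub> x \<otimes>\<^bsub>G\<^esub> g)"
proof -
  have "(single \<alpha> x \<otimes>\<^bsub>R\<^esub> u) g =
      (\<Oplus>\<^bsub>F\<^esub>h\<in>carrier G. if x = h then \<alpha> \<otimes>\<^bsub>F\<^esub> u (inv\<^bsub>G\<^esub> h \<otimes>\<^bsub>G\<^esub> g) else \<zero>\<^bsub>F\<^esub>)"
    by (auto simp: mult_apply intro!: F.finsum_cong')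
  also have "\<dots> = \<alpha> \<otimes>\<^bsub>F\<^esub> u (inv\<^bsub>G\<^esub> x \<otimes>\<^bsub>G\<^esub> g)"
    by (rule F.finsum_singleton) (auto simp: finite_group)
  finally show ?thesis .
qed

lemma mult_single_apply:
  assumes [simp]: "\<alpha> \<in> carrier F" "x \<in> carrier G" "u \<in> carrier R" "g \<in> carrier G"
  shows "(u \<otimes>\<^bsub>R\<^esub> single \<alpha> x) g = u (g \<otimes>\<^bsub>G\<^esub> inv\<^bsub>G\<^esub> x) \<otimes>\<^bsub>F\<^esub> \<alpha>"
proof -
  have eq: "inv\<^bsub>G\<^esub> h \<otimes>\<^bsub>G\<^esub> g = x \<longleftrightarrow> g \<otimes>\<^bsub>G\<^esub> inv\<^bsub>G\<^esub> x = h" if "h \<in> carrier G" for h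
    using that assms by (metis G.inv_closed G.inv_solve_left G.inv_solve_right)
  have "(u \<otimes>\<^bsub>R\<^esub> single \<alpha> x) g =
      (\<Oplus>\<^bsub>F\<^esub>h\<in>carrier G. if g \<otimes>\<^bsub>G\<^esub> inv\<^bsub>G\<^esub> x = h then u h \<otimes>\<^bsub>F\<^esub> \<alpha> else \<zero>\<^bsub>F\<^esub>)"
    by (auto simp: mult_apply eq intro!: F.finsum_cong')
  also have "\<dots> = u (g \<otimes>\<^bsub>G\<^esub> inv\<^bsub>G\<^esub> x) \<otimes>\<^bsub>F\<^esub> \<alpha>"
    by (rule F.finsum_singleton) (auto simp: finite_group)
  finally show ?thesis .
qed

lemma ring_group_algebra: "ring R"
proof (rule ringI)
  show "abelian_group R"
  proof (rule abelian_groupI)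
    fix u assume u: "u \<in> carrier R"
    show "\<exists>v\<in>carrier R. v \<oplus>\<^bsub>R\<^esub> u = \<zero>\<^bsub>R\<^esub>"
      by (rule bexI[of _ "\<lambda>g\<in>carrier G. \<ominus>\<^bsub>F\<^esub> u g"])
        (use u in \<open>auto simp: group_algebra_def F.l_neg PiE_mem intro!: restrict_ext\<close>)
  next
    fix u assume u: "u \<in> carrier R"
    show "\<zero>\<^bsub>R\<^esub> \<oplus>\<^bsub>R\<^esub> u = u"
      by (rule group_ring_eqI) (auto simp: u intro!: zero_closed' add_closed')
  next
    fix u v assume uv: "u \<in> carrier R" "v \<in> carrier R" 
    show "u \<oplus>\<^bsub>R\<^esub> v = v \<oplus>\<^bsub>R\<^esub> u"
      by (rule group_ring_eqI) (auto simp: uv F.a_comm intro!: zero_closed' add_closed')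
  next
    fix u v w assume uv: "u \<in> carrier R" "v \<in> carrier R"  "w \<in> carrier R" 
    show "u \<oplus>\<^bsub>R\<^esub> v \<oplus>\<^bsub>R\<^esub> w = u \<oplus>\<^bsub>R\<^esub> (v \<oplus>\<^bsub>R\<^esub> w)"
      by (rule group_ring_eqI) (auto simp: uv F.a_assoc intro!: zero_closed' add_closed')
  qed (auto intro: add_closed' zero_closed')
next
  show "monoid R"
  proof (rule monoidI)
    fix u assume u: "u \<in> carrier R"
    show "\<one>\<^bsub>R\<^esub> \<otimes>\<^bsub>R\<^esub> u = u" unfolding one_eq_single
      by (rule group_ring_eqI) (auto simp: u single_mult_apply intro!: mult_closed')
    show "u \<otimes>\<^bsub>R\<^esub> \<one>\<^bsub>R\<^esub> = u" unfolding one_eq_single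
      by (rule group_ring_eqI) (auto simp: u mult_single_apply intro!: mult_closed')
  qed (simp_all add: one_eq_single mult_closed' mult_assoc')
next
  fix u v w assume uvw: "u \<in> carrier R" "v \<in> carrier R" "w \<in> carrier R"
  show "(u \<oplus>\<^bsub>R\<^esub> v) \<otimes>\<^bsub>R\<^esub> w = u \<otimes>\<^bsub>R\<^esub> w \<oplus>\<^bsub>R\<^esub> v \<otimes>\<^bsub>R\<^esub> w"
    using uvw by (intro group_ring_eqI)
      (simp_all add: mult_apply F.l_distr Pi_def add_closed' mult_closed' cong: F.finsum_cong)
  show "w \<otimes>\<^bsub>R\<^esub> (u \<oplus>\<^bsub>R\<^esub> v) = w \<otimes>\<^bsub>R\<^esub> u \<oplus>\<^bsub>R\<^esub> w \<otimes>\<^bsub>R\<^esub> v"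
    using uvw by (intro group_ring_eqI)
      (simp_all add: mult_apply F.r_distr Pi_def add_closed' mult_closed' cong: F.finsum_cong)
qed

sublocale R: ring R by (rule ring_group_algebra)

text \<open>The augmentation homomorphism \<open>FG \<rightarrow> F\<close>.\<close>
definition aug :: "('g \<Rightarrow> 'f) \<Rightarrow> 'f" where
  "aug u = (\<Oplus>\<^bsub>F\<^esub>g\<in>carrier G. u g)"

lemma aug_closed [simp]: "u \<in> carrier R \<Longrightarrow> aug u \<in> carrier F"
  by (auto simp: aug_def intro!: F.finsum_closed)

lemma aug_single [simp]: "\<alpha> \<in> carrier F \<Longrightarrow> x \<in> carrier G \<Longrightarrow> aug (single \<alpha> x) = \<alpha>"
proof -
  assume *: "\<alpha> \<in> carrier F" "x \<in> carrier G"
  have "aug (single \<alpha> x) = (\<Oplus>\<^bsub>F\<^esub>g\<in>carrier G. if x = g then \<alpha> else \<zero>\<^bsub>F\<^esub>)"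
    unfolding aug_def by (rule F.finsum_cong') (auto simp: *)
  also have "\<dots> = \<alpha>" by (rule F.finsum_singleton) (auto simp: * finite_group)
  finally show ?thesis .
qed

lemma aug_add [simp]:
  "u \<in> carrier R \<Longrightarrow> v \<in> carrier R \<Longrightarrow> aug (u \<oplus>\<^bsub>R\<^esub> v) = aug u \<oplus>\<^bsub>F\<^esub> aug v"
  by (simp add: aug_def Pi_def cong: F.finsum_cong)

lemma aug_mult [simp]:
  assumes u: "u \<in> carrier R" and v: "v \<in> carrier R"
  shows "aug (u \<otimes>\<^bsub>R\<^esub> v) = aug u \<otimes>\<^bsub>F\<^esub> aug v"
proof -
  have "aug (u \<otimes>\<^bsub>R\<^esub> v) = (\<Oplus>\<^bsub>F\<^esub>g\<in>carrier G. (u \<otimes>\<^bsub>R\<^esub> v) g \<otimes>\<^bsub>F\<^esub> \<one>\<^bsub>F\<^esub>)"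
    unfolding aug_def by (rule F.finsum_cong') (auto simp: u v)
  also have "\<dots> = (\<Oplus>\<^bsub>F\<^esub>h\<in>carrier G. \<Oplus>\<^bsub>F\<^esub>k\<in>carrier G. u h \<otimes>\<^bsub>F\<^esub> v k \<otimes>\<^bsub>F\<^esub> \<one>\<^bsub>F\<^esub>)"
    by (rule sum_mult_pairing) (auto simp: u v)
  also have "\<dots> = (\<Oplus>\<^bsub>F\<^esub>h\<in>carrier G. u h \<otimes>\<^bsub>F\<^esub> aug v)"
    unfolding aug_def
    by (intro F.finsum_cong')
       (auto simp: u v finite_group F.finsum_rdistr Pi_def intro!: F.finsum_closed F.finsum_cong')
  also have "\<dots> = aug u \<otimes>\<^bsub>F\<^esub> aug v"
    unfolding aug_def[of u] by (subst F.finsum_ldistr) (auto simp: u v finite_group Pi_def)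
  finally show ?thesis .
qed

lemma single_mult_single [simp]:
  assumes "\<alpha> \<in> carrier F" "\<beta> \<in> carrier F" "x \<in> carrier G" "y \<in> carrier G"
  shows "single \<alpha> x \<otimes>\<^bsub>R\<^esub> single \<beta> y = single (\<alpha> \<otimes>\<^bsub>F\<^esub> \<beta>) (x \<otimes>\<^bsub>G\<^esub> y)"
proof (rule group_ring_eqI)
  fix g assume g: "g \<in> carrier G"
  have "inv\<^bsub>G\<^esub> x \<otimes>\<^bsub>G\<^esub> g = y \<longleftrightarrow> g = x \<otimes>\<^bsub>G\<^esub> y"
    using assms g by (metis G.inv_solve_left')
  then show "(single \<alpha> x \<otimes>\<^bsub>R\<^esub> single \<beta> y) g = single (\<alpha> \<otimes>\<^bsub>F\<^esub> \<beta>) (x \<otimes>\<^bsub>G\<^esub> y) g"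
    using assms g by (simp add: single_mult_apply)
qed (use assms in auto)

lemma single_pow:
  assumes "\<alpha> \<in> carrier F" "x \<in> carrier G"
  shows "single \<alpha> x [^]\<^bsub>R\<^esub> (n::nat) = single (\<alpha> [^]\<^bsub>F\<^esub> n) (x [^]\<^bsub>G\<^esub> n)"
  using assms by (induction n) (auto simp: one_eq_single)

text \<open>
  The elements \<open>\<alpha>x\<close> span the group ring additively. Statements that are additive in \<open>u\<close> need to be
  checked on them only.
\<close>
lemma group_ring_induct [consumes 1, case_names zero add_single]:
  assumes u: "u \<in> carrier R"
    and zero: "P \<zero>\<^bsub>R\<^esub>"
    and add: "\<And>u \<alpha> x. u \<in> carrier R \<Longrightarrow> P u \<Longrightarrow> \<alpha> \<in> carrier F \<Longrightarrow> x \<in> carrier G \<Longrightarrow>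
      P (u \<oplus>\<^bsub>R\<^esub> single \<alpha> x)"
  shows "P u"
proof -
  define cut where "cut S = (\<lambda>g\<in>carrier G. if g \<in> S then u g else \<zero>\<^bsub>F\<^esub>)" for S
  have cut: "cut S \<in> carrier R" for S
    using u by (auto simp: cut_def carrier_R)
  have "P (cut S)" if "finite S" "S \<subseteq> carrier G" for S
    using that
  proof (induction S rule: finite_induct)
    case empty
    have "cut {} = \<zero>\<^bsub>R\<^esub>"
      by (rule group_ring_eqI[OF cut]) (auto simp: cut_def)
    then show ?case using zero by simp
  next
    case (insert x S)
    have "cut (insert x S) = cut S \<oplus>\<^bsub>R\<^esub> single (u x) x"
      by (rule group_ring_eqI[OF cut]) (use insert u cut in \<open>auto simp: cut_def\<close>)
    then show ?case using insert add[OF cut, of S "u x" x] u by auto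
  qed
  moreover have "cut (carrier G) = u"
    by (rule group_ring_eqI[OF cut u]) (auto simp: cut_def)
  ultimately show ?thesis using finite_group by (metis order_refl)
qed

lemma torsion_R:
  assumes "[(n::nat)] \<cdot>\<^bsub>F\<^esub> \<one>\<^bsub>F\<^esub> = \<zero>\<^bsub>F\<^esub>"
  shows "[n] \<cdot>\<^bsub>R\<^esub> \<one>\<^bsub>R\<^esub> = \<zero>\<^bsub>R\<^esub>"
proof -
  have "([m] \<cdot>\<^bsub>R\<^esub> u) g = [m] \<cdot>\<^bsub>F\<^esub> u g" if "u \<in> carrier R" "g \<in> carrier G" for m :: nat and u g
    using that by (induction m) (auto simp: F.add.nat_pow_Suc R.add.nat_pow_Suc)
  then show ?thesis
    using assms by (intro group_ring_eqI) (auto simp: F.torsion_if_torsion_one)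
qed

abbreviation basis :: "'g \<Rightarrow> 'g \<Rightarrow> 'f" where "basis x \<equiv> single \<one>\<^bsub>F\<^esub> x"

definition central :: "'g \<Rightarrow> bool" where
  "central c \<longleftrightarrow> c \<in> carrier G \<and> (\<forall>x\<in>carrier G. x \<otimes>\<^bsub>G\<^esub> c = c \<otimes>\<^bsub>G\<^esub> x)"

lemma centralD: "central c \<Longrightarrow> c \<in> carrier G" "central c \<Longrightarrow> x \<in> carrier G \<Longrightarrow> x \<otimes>\<^bsub>G\<^esub> c = c \<otimes>\<^bsub>G\<^esub> x"
  by (auto simp: central_def)

lemma central_mult: "central c \<Longrightarrow> central d \<Longrightarrow> central (c \<otimes>\<^bsub>G\<^esub> d)"
  unfolding central_def by (metis G.m_assoc G.m_closed)

lemma central_inv: "central c \<Longrightarrow> central (inv\<^bsub>G\<^esub> c)"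
  unfolding central_def by (metis G.inv_closed G.inv_solve_left G.inv_solve_right G.m_assoc G.m_closed)

lemma central_one: "central \<one>\<^bsub>G\<^esub>" by (simp add: central_def)

lemma central_pow: "central c \<Longrightarrow> central (c [^]\<^bsub>G\<^esub> (n::nat))"
  by (induction n) (auto simp: central_one central_mult)

definition center_supported :: "('g \<Rightarrow> 'f) set" where
  "center_supported = {u \<in> carrier R. \<forall>g\<in>carrier G. \<not> central g \<longrightarrow> u g = \<zero>\<^bsub>F\<^esub>}"

lemma center_supportedD:
  "u \<in> center_supported \<Longrightarrow> u \<in> carrier R"
  "u \<in> center_supported \<Longrightarrow> g \<in> carrier G \<Longrightarrow> \<not> central g \<Longrightarrow> u g = \<zero>\<^bsub>F\<^esub>"
  by (auto simp: center_supported_def)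

lemma single_center_supported: "\<alpha> \<in> carrier F \<Longrightarrow> central c \<Longrightarrow> single \<alpha> c \<in> center_supported"
  by (auto simp: center_supported_def)

lemma center_supported_add:
  "u \<in> center_supported \<Longrightarrow> v \<in> center_supported \<Longrightarrow> u \<oplus>\<^bsub>R\<^esub> v \<in> center_supported"
  by (auto simp: center_supported_def)

text \<open>If \<open>h k\<close> is not central, then \<open>h\<close> or \<open>k\<close> is not.\<close>
lemma center_supported_mult:
  assumes u: "u \<in> center_supported" and v: "v \<in> center_supported"
  shows "u \<otimes>\<^bsub>R\<^esub> v \<in> center_supported"
proof -
  have "(u \<otimes>\<^bsub>R\<^esub> v) g = \<zero>\<^bsub>F\<^esub>" if g: "g \<in> carrier G" "\<not> central g" for g
    unfolding mult_apply[OF g(1)]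
  proof (rule F.add.finprod_one_eqI)
    fix h assume h: "h \<in> carrier G"
    have "\<not> central h \<or> \<not> central (inv\<^bsub>G\<^esub> h \<otimes>\<^bsub>G\<^esub> g)"
      using g h central_mult[of h "inv\<^bsub>G\<^esub> h \<otimes>\<^bsub>G\<^esub> g"] by (auto simp: G.m_assoc[symmetric])
    then show "u h \<otimes>\<^bsub>F\<^esub> v (inv\<^bsub>G\<^esub> h \<otimes>\<^bsub>G\<^esub> g) = \<zero>\<^bsub>F\<^esub>"
      using u v h g by (auto simp: center_supported_def)
  qed
  then show ?thesis using u v by (auto simp: center_supported_def)
qed

text \<open>
  It suffices to compare \<open>uy\<close> with \<open>yu\<close> for a group element \<open>y\<close>, that is, the coefficients of \<open>u\<close> at
  the conjugate elements \<open>gy\<^sup>-\<^sup>1\<close> and \<open>y\<^sup>-\<^sup>1g\<close>. These elements are equal as soon as one of them is central.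
\<close>
lemma center_supported_commutes:
  assumes u: "u \<in> center_supported" and v: "v \<in> carrier R"
  shows "u \<otimes>\<^bsub>R\<^esub> v = v \<otimes>\<^bsub>R\<^esub> u"
  using v
proof (induction v rule: group_ring_induct)
  case (add_single v \<beta> y)
  have "u \<otimes>\<^bsub>R\<^esub> single \<beta> y = single \<beta> y \<otimes>\<^bsub>R\<^esub> u"
  proof (rule group_ring_eqI)
    fix g assume g: "g \<in> carrier G"
    have y: "y \<in> carrier G" by fact
    have "u (g \<otimes>\<^bsub>G\<^esub> inv\<^bsub>G\<^esub> y) = u (inv\<^bsub>G\<^esub> y \<otimes>\<^bsub>G\<^esub> g)"
    proof (cases "central (g \<otimes>\<^bsub>G\<^esub> inv\<^bsub>G\<^esub> y) \<or> central (inv\<^bsub>G\<^esub> y \<otimes>\<^bsub>G\<^esub> g)")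
      case True
      have "inv\<^bsub>G\<^esub> y \<otimes>\<^bsub>G\<^esub> (g \<otimes>\<^bsub>G\<^esub> inv\<^bsub>G\<^esub> y) \<otimes>\<^bsub>G\<^esub> y = inv\<^bsub>G\<^esub> y \<otimes>\<^bsub>G\<^esub> g"
        "y \<otimes>\<^bsub>G\<^esub> (inv\<^bsub>G\<^esub> y \<otimes>\<^bsub>G\<^esub> g) \<otimes>\<^bsub>G\<^esub> inv\<^bsub>G\<^esub> y = g \<otimes>\<^bsub>G\<^esub> inv\<^bsub>G\<^esub> y"
        using g y by (simp_all add: G.m_assoc) (simp add: G.m_assoc[symmetric])
      moreover have "inv\<^bsub>G\<^esub> y \<otimes>\<^bsub>G\<^esub> c \<otimes>\<^bsub>G\<^esub> y = c" "y \<otimes>\<^bsub>G\<^esub> c \<otimes>\<^bsub>G\<^esub> inv\<^bsub>G\<^esub> y = c" if "central c" for c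
        using that y centralD[OF that] by (simp_all add: G.m_assoc)
      ultimately have "g \<otimes>\<^bsub>G\<^esub> inv\<^bsub>G\<^esub> y = inv\<^bsub>G\<^esub> y \<otimes>\<^bsub>G\<^esub> g" using True by metis
      then show ?thesis by simp
    qed (use u y g in \<open>simp add: center_supported_def\<close>)
    then show "(u \<otimes>\<^bsub>R\<^esub> single \<beta> y) g = (single \<beta> y \<otimes>\<^bsub>R\<^esub> u) g"
      using add_single u g by (simp add: single_mult_apply mult_single_apply center_supportedD F.m_comm)
  qed (use u add_single in \<open>auto simp: center_supportedD\<close>)
  then show ?case using add_single u by (simp add: R.l_distr R.r_distr center_supportedD)
qed (use u in \<open>simp add: center_supportedD\<close>)

end

text \<open>The ring homomorphism \<open>FG \<rightarrow> FH\<close> induced by a group homomorphism \<open>G \<rightarrow> H\<close>.\<close>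
locale group_ring_push = group_ring F G + H: group_ring F H
  for F :: "('f, 'r) ring_scheme" and G :: "('g, 'm) monoid_scheme" and H :: "('h, 'n) monoid_scheme" +
  fixes \<phi> :: "'g \<Rightarrow> 'h"
  assumes hom: "\<phi> \<in> hom G H"
begin

definition push :: "('g \<Rightarrow> 'f) \<Rightarrow> 'h \<Rightarrow> 'f" where
  "push u = (\<lambda>h\<in>carrier H. \<Oplus>\<^bsub>F\<^esub>g\<in>carrier G. if \<phi> g = h then u g else \<zero>\<^bsub>F\<^esub>)"

lemma \<phi>_closed [simp]: "g \<in> carrier G \<Longrightarrow> \<phi> g \<in> carrier H"
  using hom by (auto simp: hom_def)

lemma push_closed [simp]: "u \<in> carrier R \<Longrightarrow> push u \<in> carrier H.R"
  unfolding push_def H.carrier_R by (auto intro!: F.finsum_closed)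

lemma push_add: 
  assumes "u \<in> carrier R" "v \<in> carrier R"
  shows "push (u \<oplus>\<^bsub>R\<^esub> v) = push u \<oplus>\<^bsub>H.R\<^esub> push v"
proof (rule H.group_ring_eqI)
  fix h assume h: "h \<in> carrier H"
  have "(\<Oplus>\<^bsub>F\<^esub>g\<in>carrier G. if \<phi> g = h then (u \<oplus>\<^bsub>R\<^esub> v) g else \<zero>\<^bsub>F\<^esub>) = 
    (\<Oplus>\<^bsub>F\<^esub>g\<in>carrier G. (if \<phi> g = h then u g else \<zero>\<^bsub>F\<^esub>) \<oplus>\<^bsub>F\<^esub> (if \<phi> g = h then v g else \<zero>\<^bsub>F\<^esub>))"
    using assms by (intro F.finsum_cong') auto
  then show "push (u \<oplus>\<^bsub>R\<^esub> v) h = (push u \<oplus>\<^bsub>H.R\<^esub> push v) h"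
    using assms h by (simp add: push_def Pi_def)
qed (use assms in auto)

lemma push_single [simp]: 
  assumes "\<alpha> \<in> carrier F" "x \<in> carrier G"
  shows "push (single \<alpha> x) = H.single \<alpha> (\<phi> x)"
proof (rule H.group_ring_eqI)
  fix h assume h: "h \<in> carrier H"
  have "push (single \<alpha> x) h = (\<Oplus>\<^bsub>F\<^esub>g\<in>carrier G. if x = g then (if \<phi> g = h then \<alpha> else \<zero>\<^bsub>F\<^esub>) else \<zero>\<^bsub>F\<^esub>)"
    using assms h by (auto simp: push_def intro!: F.finsum_cong')
  also have "\<dots> = (if \<phi> x = h then \<alpha> else \<zero>\<^bsub>F\<^esub>)"
    by (rule F.finsum_singleton) (use assms finite_group in auto)
  finally show "push (single \<alpha> x) h = H.single \<alpha> (\<phi> x) h" using h by auto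
qed (use assms in auto)

lemma push_zero [simp]: "push \<zero>\<^bsub>R\<^esub> = \<zero>\<^bsub>H.R\<^esub>"
proof (rule H.group_ring_eqI)
  fix h assume h: "h \<in> carrier H"
  have "(\<Oplus>\<^bsub>F\<^esub>g\<in>carrier G. if \<phi> g = h then \<zero>\<^bsub>R\<^esub> g else \<zero>\<^bsub>F\<^esub>) = \<zero>\<^bsub>F\<^esub>"
    by (rule F.add.finprod_one_eqI) auto
  then show "push \<zero>\<^bsub>R\<^esub> h = \<zero>\<^bsub>H.R\<^esub> h" using h by (simp add: push_def)
qed auto

lemma push_mult:
  assumes u: "u \<in> carrier R" and v: "v \<in> carrier R"
  shows "push (u \<otimes>\<^bsub>R\<^esub> v) = push u \<otimes>\<^bsub>H.R\<^esub> push v"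
proof -
  have single: "push (single \<alpha> x \<otimes>\<^bsub>R\<^esub> v) = H.single \<alpha> (\<phi> x) \<otimes>\<^bsub>H.R\<^esub> push v"
    if [simp]: "\<alpha> \<in> carrier F" "x \<in> carrier G" for \<alpha> x
    using v
  proof (induction v rule: group_ring_induct)
    case zero
    then show ?case by simp
  next
    case (add_single v \<beta> y)
    then show ?case
      by (simp add: R.r_distr H.R.r_distr push_add hom_mult[OF hom])
  qed
  from u show ?thesis
  proof (induction u rule: group_ring_induct)
    case zero
    then show ?case using v by simp
  next
    case (add_single u \<alpha> x)
    then show ?case
      by (simp add: v R.l_distr H.R.l_distr push_add single)
  qed
qed

lemma push_one: "push \<one>\<^bsub>R\<^esub> = \<one>\<^bsub>H.R\<^esub>"
  using hom_one[OF hom G.is_group H.G.is_group] by (simp add: one_eq_single H.one_eq_single)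

lemma push_pow: "u \<in> carrier R \<Longrightarrow> push (u [^]\<^bsub>R\<^esub> (n::nat)) = push u [^]\<^bsub>H.R\<^esub> n"
  by (induction n) (simp_all add: push_one push_mult)

lemma push_product_of_powers:
  assumes "set us \<subseteq> carrier R" and "\<one>\<^bsub>H.R\<^esub> \<in> S"
    and "\<And>s s'. s \<in> S \<Longrightarrow> s' \<in> S \<Longrightarrow> s \<otimes>\<^bsub>H.R\<^esub> s' \<in> S"
    and "\<And>v. v \<in> carrier H.R \<Longrightarrow> v [^]\<^bsub>H.R\<^esub> (k::nat) \<in> S"
  shows "foldr (\<otimes>\<^bsub>R\<^esub>) (map (\<lambda>u. u [^]\<^bsub>R\<^esub> k) us) \<one>\<^bsub>R\<^esub> \<in> carrier R \<and>
    push (foldr (\<otimes>\<^bsub>R\<^esub>) (map (\<lambda>u. u [^]\<^bsub>R\<^esub> k) us) \<one>\<^bsub>R\<^esub>) \<in> S"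
  using assms(1) by (induction us) (auto simp: push_mult push_one push_pow assms(2-))

end

section \<open>Group rings with central commutators\<close>

text \<open>
  The situation in a minimal nonabelian quotient: the commutator subgroup lies in the central
  subgroup \<open>\<langle>z\<rangle>\<close>, whose order divides \<open>p\<close>.
\<close>
locale central_commutator_group_ring = group_ring F G
  for F :: "('f, 'r) ring_scheme" and G :: "('g, 'm) monoid_scheme" +
  fixes p :: nat and z :: 'g
  assumes p: "Factorial_Ring.prime p"
    and torsion_F: "[p] \<cdot>\<^bsub>F\<^esub> \<one>\<^bsub>F\<^esub> = \<zero>\<^bsub>F\<^esub>"
    and one_not_zero: "\<one>\<^bsub>F\<^esub> \<noteq> \<zero>\<^bsub>F\<^esub>"
    and central_z: "central z"
    and z_pow_p: "z [^]\<^bsub>G\<^esub> p = \<one>\<^bsub>G\<^esub>"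
    and commutator_z: "\<And>x y. x \<in> carrier G \<Longrightarrow> y \<in> carrier G \<Longrightarrow>
      \<exists>i::nat. x \<otimes>\<^bsub>G\<^esub> y = z [^]\<^bsub>G\<^esub> i \<otimes>\<^bsub>G\<^esub> (y \<otimes>\<^bsub>G\<^esub> x)"
begin

lemma torsion: "[p] \<cdot>\<^bsub>R\<^esub> \<one>\<^bsub>R\<^esub> = \<zero>\<^bsub>R\<^esub>"
  using torsion_R[OF torsion_F] .

definition t :: "'g \<Rightarrow> 'f" where "t = basis z \<ominus>\<^bsub>R\<^esub> \<one>\<^bsub>R\<^esub>"

lemma z_closed [simp]: "z \<in> carrier G" using central_z by (rule centralD)

lemma t_closed [simp]: "t \<in> carrier R" by (simp add: t_def)

lemma t_comm: "u \<in> carrier R \<Longrightarrow> u \<otimes>\<^bsub>R\<^esub> t = t \<otimes>\<^bsub>R\<^esub> u"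
  using center_supported_commutes[OF single_center_supported[OF _ central_z], of "\<one>\<^bsub>F\<^esub>" u]
  by (simp add: t_def R.minus_eq R.l_distr R.r_distr R.l_minus R.r_minus)

text \<open>Frobenius applied to \<open>z = t + 1\<close> gives \<open>1 = z\<^sup>p = t\<^sup>p + 1\<close>.\<close>
lemma t_pow_p: "t [^]\<^bsub>R\<^esub> p = \<zero>\<^bsub>R\<^esub>"
proof -
  have "t \<oplus>\<^bsub>R\<^esub> \<one>\<^bsub>R\<^esub> = basis z" by (simp add: t_def R.minus_eq R.a_assoc R.l_neg)
  then have "t [^]\<^bsub>R\<^esub> p \<oplus>\<^bsub>R\<^esub> \<one>\<^bsub>R\<^esub> = basis z [^]\<^bsub>R\<^esub> p"
    using R.frobenius_add[OF p torsion, of t "\<one>\<^bsub>R\<^esub>"] by simp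
  also have "\<dots> = \<one>\<^bsub>R\<^esub>" by (simp add: single_pow z_pow_p one_eq_single)
  finally show ?thesis using R.add.r_cancel_one[of "\<one>\<^bsub>R\<^esub>" "t [^]\<^bsub>R\<^esub> p"] by simp
qed

text \<open>
  The ideal \<open>tR\<close>, two-sided as \<open>t\<close> is central. It is the kernel of \<open>FG \<rightarrow> F[G/\<langle>z\<rangle>]\<close>, a map to a
  commutative ring.
\<close>
definition J :: "('g \<Rightarrow> 'f) set" where "J = {t \<otimes>\<^bsub>R\<^esub> r | r. r \<in> carrier R}"

lemma J_closed: "u \<in> J \<Longrightarrow> u \<in> carrier R" by (auto simp: J_def)

lemma J_add: "u \<in> J \<Longrightarrow> v \<in> J \<Longrightarrow> u \<oplus>\<^bsub>R\<^esub> v \<in> J"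
  unfolding J_def by (auto simp: R.r_distr[symmetric])

lemma J_mult: assumes "u \<in> J" and "v \<in> carrier R" shows "u \<otimes>\<^bsub>R\<^esub> v \<in> J"
  using assms unfolding J_def by (auto simp: R.m_assoc)

lemma basis_z_pow_diff_in_J: "basis (z [^]\<^bsub>G\<^esub> (i::nat)) \<ominus>\<^bsub>R\<^esub> \<one>\<^bsub>R\<^esub> \<in> J"
proof (induction i)
  case 0
  have "t \<otimes>\<^bsub>R\<^esub> \<zero>\<^bsub>R\<^esub> \<in> J" unfolding J_def by blast
  then show ?case by (simp add: one_eq_single[symmetric] R.minus_eq R.r_neg)
next
  case (Suc i)
  let ?a = "basis (z [^]\<^bsub>G\<^esub> i)" and ?b = "basis z"
  have "?a \<otimes>\<^bsub>R\<^esub> ?b \<ominus>\<^bsub>R\<^esub> \<one>\<^bsub>R\<^esub> = (?a \<ominus>\<^bsub>R\<^esub> \<one>\<^bsub>R\<^esub>) \<otimes>\<^bsub>R\<^esub> ?b \<oplus>\<^bsub>R\<^esub> t"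
    by (simp add: t_def R.minus_eq R.l_distr R.l_minus R.a_assoc R.r_neg1 R.r_neg2 del: single_mult_single)
  moreover have "t \<in> J" unfolding J_def using R.r_one[OF t_closed] by force
  ultimately show ?case using Suc by (simp add: J_add J_mult)
qed

text \<open>
  On group elements \<open>xy - yx = (z\<^sup>i - 1) yx\<close> for some \<open>i\<close>; the general case follows by bilinearity.
\<close>
lemma lie_bracket_in_J:
  assumes u: "u \<in> carrier R" and v: "v \<in> carrier R"
  shows "u \<otimes>\<^bsub>R\<^esub> v \<ominus>\<^bsub>R\<^esub> v \<otimes>\<^bsub>R\<^esub> u \<in> J"
proof -
  have zero: "\<zero>\<^bsub>R\<^esub> \<in> J" unfolding J_def using R.r_null[OF t_closed] by force
  have single: "single \<alpha> x \<otimes>\<^bsub>R\<^esub> v \<ominus>\<^bsub>R\<^esub> v \<otimes>\<^bsub>R\<^esub> single \<alpha> x \<in> J"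
    if \<alpha>[simp]: "\<alpha> \<in> carrier F" and x[simp]: "x \<in> carrier G" for \<alpha> x
    using v
  proof (induction v rule: group_ring_induct)
    case zero
    then show ?case using \<open>\<zero>\<^bsub>R\<^esub> \<in> J\<close> by (simp add: R.minus_eq)
  next
    case (add_single v \<beta> y)
    note [simp] = \<open>v \<in> carrier R\<close> \<open>\<beta> \<in> carrier F\<close> \<open>y \<in> carrier G\<close>
    obtain i :: nat where i: "x \<otimes>\<^bsub>G\<^esub> y = z [^]\<^bsub>G\<^esub> i \<otimes>\<^bsub>G\<^esub> (y \<otimes>\<^bsub>G\<^esub> x)"
      using commutator_z[of x y] by auto
    have "single \<alpha> x \<otimes>\<^bsub>R\<^esub> single \<beta> y \<ominus>\<^bsub>R\<^esub> single \<beta> y \<otimes>\<^bsub>R\<^esub> single \<alpha> x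
      = (basis (z [^]\<^bsub>G\<^esub> i) \<ominus>\<^bsub>R\<^esub> \<one>\<^bsub>R\<^esub>) \<otimes>\<^bsub>R\<^esub> single (\<alpha> \<otimes>\<^bsub>F\<^esub> \<beta>) (y \<otimes>\<^bsub>G\<^esub> x)"
      by (simp add: i R.minus_eq R.l_distr R.l_minus F.m_comm)
    then have "single \<alpha> x \<otimes>\<^bsub>R\<^esub> single \<beta> y \<ominus>\<^bsub>R\<^esub> single \<beta> y \<otimes>\<^bsub>R\<^esub> single \<alpha> x \<in> J"
      by (simp add: J_mult basis_z_pow_diff_in_J del: single_mult_single)
    moreover have "single \<alpha> x \<otimes>\<^bsub>R\<^esub> (v \<oplus>\<^bsub>R\<^esub> single \<beta> y) \<ominus>\<^bsub>R\<^esub> (v \<oplus>\<^bsub>R\<^esub> single \<beta> y) \<otimes>\<^bsub>R\<^esub> single \<alpha> x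
      = (single \<alpha> x \<otimes>\<^bsub>R\<^esub> v \<ominus>\<^bsub>R\<^esub> v \<otimes>\<^bsub>R\<^esub> single \<alpha> x) \<oplus>\<^bsub>R\<^esub>
        (single \<alpha> x \<otimes>\<^bsub>R\<^esub> single \<beta> y \<ominus>\<^bsub>R\<^esub> single \<beta> y \<otimes>\<^bsub>R\<^esub> single \<alpha> x)"
      by (simp add: R.minus_eq R.l_distr R.r_distr R.minus_add R.a_ac del: single_mult_single)
    ultimately show ?case using add_single by (simp add: J_add del: single_mult_single)
  qed
  from u show ?thesis
  proof (induction u rule: group_ring_induct)
    case zero
    then show ?case using \<open>\<zero>\<^bsub>R\<^esub> \<in> J\<close> v by (simp add: R.minus_eq)
  next
    case (add_single u \<alpha> x)
    have "(u \<oplus>\<^bsub>R\<^esub> single \<alpha> x) \<otimes>\<^bsub>R\<^esub> v \<ominus>\<^bsub>R\<^esub> v \<otimes>\<^bsub>R\<^esub> (u \<oplus>\<^bsub>R\<^esub> single \<alpha> x)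
      = (u \<otimes>\<^bsub>R\<^esub> v \<ominus>\<^bsub>R\<^esub> v \<otimes>\<^bsub>R\<^esub> u) \<oplus>\<^bsub>R\<^esub> (single \<alpha> x \<otimes>\<^bsub>R\<^esub> v \<ominus>\<^bsub>R\<^esub> v \<otimes>\<^bsub>R\<^esub> single \<alpha> x)"
      using add_single v by (simp add: R.minus_eq R.l_distr R.r_distr R.minus_add R.a_ac)
    then show ?case using add_single single by (simp add: J_add)
  qed
qed

text \<open>Each application of \<open>ad u\<close> produces another central factor \<open>t\<close>, and \<open>t\<^sup>p = 0\<close>.\<close>
lemma pow_p_commutes:
  assumes u: "u \<in> carrier R" and v: "v \<in> carrier R"
  shows "u [^]\<^bsub>R\<^esub> p \<otimes>\<^bsub>R\<^esub> v = v \<otimes>\<^bsub>R\<^esub> u [^]\<^bsub>R\<^esub> p"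
proof (rule R.prime_power_commutes_if_ad_nilpotent[OF p torsion u v])
  have "\<exists>r\<in>carrier R. ((\<lambda>x. u \<otimes>\<^bsub>R\<^esub> x \<ominus>\<^bsub>R\<^esub> x \<otimes>\<^bsub>R\<^esub> u) ^^ k) v = t [^]\<^bsub>R\<^esub> k \<otimes>\<^bsub>R\<^esub> r" for k
  proof (induction k)
    case 0
    then show ?case using v by auto
  next
    case (Suc k)
    then obtain r where r: "r \<in> carrier R"
      "((\<lambda>x. u \<otimes>\<^bsub>R\<^esub> x \<ominus>\<^bsub>R\<^esub> x \<otimes>\<^bsub>R\<^esub> u) ^^ k) v = t [^]\<^bsub>R\<^esub> k \<otimes>\<^bsub>R\<^esub> r" by blast
    obtain r' where r': "r' \<in> carrier R" "u \<otimes>\<^bsub>R\<^esub> r \<ominus>\<^bsub>R\<^esub> r \<otimes>\<^bsub>R\<^esub> u = t \<otimes>\<^bsub>R\<^esub> r'"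
      using lie_bracket_in_J[OF u r(1)] by (auto simp: J_def)
    have ut: "u \<otimes>\<^bsub>R\<^esub> t [^]\<^bsub>R\<^esub> k = t [^]\<^bsub>R\<^esub> k \<otimes>\<^bsub>R\<^esub> u"
      using R.group_commutes_pow[of t u k] t_comm[OF u] u by simp
    have "u \<otimes>\<^bsub>R\<^esub> (t [^]\<^bsub>R\<^esub> k \<otimes>\<^bsub>R\<^esub> r) \<ominus>\<^bsub>R\<^esub> t [^]\<^bsub>R\<^esub> k \<otimes>\<^bsub>R\<^esub> r \<otimes>\<^bsub>R\<^esub> u =
      t [^]\<^bsub>R\<^esub> k \<otimes>\<^bsub>R\<^esub> (u \<otimes>\<^bsub>R\<^esub> r \<ominus>\<^bsub>R\<^esub> r \<otimes>\<^bsub>R\<^esub> u)"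
    proof -
      have "u \<otimes>\<^bsub>R\<^esub> (t [^]\<^bsub>R\<^esub> k \<otimes>\<^bsub>R\<^esub> r) = t [^]\<^bsub>R\<^esub> k \<otimes>\<^bsub>R\<^esub> (u \<otimes>\<^bsub>R\<^esub> r)"
        using u r ut by (simp add: R.m_assoc[symmetric])
      then show ?thesis using u r by (simp add: R.minus_eq R.r_distr R.r_minus R.m_assoc)
    qed
    also have "\<dots> = t [^]\<^bsub>R\<^esub> Suc k \<otimes>\<^bsub>R\<^esub> r'"
      unfolding r'(2) using r' by (simp add: R.m_assoc)
    finally show ?case using r r'(1) by auto
  qed
  then obtain r where "r \<in> carrier R"
    "((\<lambda>x. u \<otimes>\<^bsub>R\<^esub> x \<ominus>\<^bsub>R\<^esub> x \<otimes>\<^bsub>R\<^esub> u) ^^ p) v = t [^]\<^bsub>R\<^esub> p \<otimes>\<^bsub>R\<^esub> r" by blast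
  then show "((\<lambda>x. u \<otimes>\<^bsub>R\<^esub> x \<ominus>\<^bsub>R\<^esub> x \<otimes>\<^bsub>R\<^esub> u) ^^ p) v = \<zero>\<^bsub>R\<^esub>"
    by (simp add: t_pow_p)
qed

text \<open>If \<open>yx = z\<^sup>i xy\<close>, then \<open>yx\<^sup>2 = z\<^sup>2\<^sup>i x\<^sup>2y\<close>, and \<open>z\<^sup>2 = 1\<close>.\<close>
lemma square_central:
  assumes p2: "p = 2" and x: "x \<in> carrier G"
  shows "central (x \<otimes>\<^bsub>G\<^esub> x)"
proof -
  have "y \<otimes>\<^bsub>G\<^esub> (x \<otimes>\<^bsub>G\<^esub> x) = (x \<otimes>\<^bsub>G\<^esub> x) \<otimes>\<^bsub>G\<^esub> y" if y: "y \<in> carrier G" for y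
  proof -
    obtain i :: nat where i: "y \<otimes>\<^bsub>G\<^esub> x = z [^]\<^bsub>G\<^esub> i \<otimes>\<^bsub>G\<^esub> (x \<otimes>\<^bsub>G\<^esub> y)"
      using commutator_z[OF y x] by auto
    let ?c = "z [^]\<^bsub>G\<^esub> i"
    have c: "?c \<in> carrier G" "x \<otimes>\<^bsub>G\<^esub> ?c = ?c \<otimes>\<^bsub>G\<^esub> x"
      using central_pow[OF central_z] x by (auto simp: central_def)
    have "?c \<otimes>\<^bsub>G\<^esub> ?c = (z [^]\<^bsub>G\<^esub> p) [^]\<^bsub>G\<^esub> i"
      by (simp add: G.nat_pow_mult G.nat_pow_pow p2 mult_2)
    then have cc: "?c \<otimes>\<^bsub>G\<^esub> ?c = \<one>\<^bsub>G\<^esub>" by (simp add: z_pow_p)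
    have "y \<otimes>\<^bsub>G\<^esub> (x \<otimes>\<^bsub>G\<^esub> x) = (y \<otimes>\<^bsub>G\<^esub> x) \<otimes>\<^bsub>G\<^esub> x" using x y by (simp add: G.m_assoc)
    also have "\<dots> = ?c \<otimes>\<^bsub>G\<^esub> x \<otimes>\<^bsub>G\<^esub> (y \<otimes>\<^bsub>G\<^esub> x)"
      unfolding i using x y c(1) by (simp add: G.m_assoc i)
    also have "\<dots> = ?c \<otimes>\<^bsub>G\<^esub> (x \<otimes>\<^bsub>G\<^esub> ?c) \<otimes>\<^bsub>G\<^esub> (x \<otimes>\<^bsub>G\<^esub> y)"
      unfolding i using x y c(1) by (simp add: G.m_assoc)
    also have "\<dots> = (?c \<otimes>\<^bsub>G\<^esub> ?c) \<otimes>\<^bsub>G\<^esub> x \<otimes>\<^bsub>G\<^esub> (x \<otimes>\<^bsub>G\<^esub> y)"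
      unfolding c(2) using x y c(1) by (simp add: G.m_assoc)
    finally show ?thesis using x y by (simp add: cc G.m_assoc)
  qed
  then show ?thesis using x by (simp add: central_def)
qed

lemma two_torsion:
  assumes "p = 2" "u \<in> carrier R"
  shows "u \<oplus>\<^bsub>R\<^esub> u = \<zero>\<^bsub>R\<^esub>"
  using R.torsion_if_torsion_one[OF torsion assms(2)] assms
  by (simp add: numeral_2_eq_2 R.add.nat_pow_Suc)

text \<open>
  Modulo \<open>tR\<close> the ring is commutative of characteristic \<open>2\<close>, so squaring is additive there; and a
  multiple of a group element has its square supported on the center.
\<close>
lemma square_decomposition:
  assumes p2: "p = 2" and u: "u \<in> carrier R"
  shows "\<exists>s\<in>center_supported. \<exists>j\<in>J. u \<otimes>\<^bsub>R\<^esub> u = s \<oplus>\<^bsub>R\<^esub> j"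
  using u
proof (induction u rule: group_ring_induct)
  case zero
  have "\<zero>\<^bsub>R\<^esub> \<in> center_supported" by (auto simp: center_supported_def)
  moreover have "\<zero>\<^bsub>R\<^esub> \<in> J" unfolding J_def using R.r_null[OF t_closed] by force
  ultimately show ?case by force
next
  case (add_single u \<alpha> x)
  note [simp] = \<open>u \<in> carrier R\<close> \<open>\<alpha> \<in> carrier F\<close> \<open>x \<in> carrier G\<close>
  obtain s j where sj: "s \<in> center_supported" "j \<in> J" "u \<otimes>\<^bsub>R\<^esub> u = s \<oplus>\<^bsub>R\<^esub> j"
    using add_single by blast
  note [simp] = center_supportedD(1)[OF sj(1)] J_closed[OF sj(2)]
  define a where "a = single \<alpha> x"
  have [simp]: "a \<in> carrier R" by (simp add: a_def)
  have aa: "a \<otimes>\<^bsub>R\<^esub> a \<in> center_supported"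
    unfolding a_def using square_central[OF p2, of x] by (simp add: single_center_supported)
  have "u \<otimes>\<^bsub>R\<^esub> a \<oplus>\<^bsub>R\<^esub> a \<otimes>\<^bsub>R\<^esub> u = u \<otimes>\<^bsub>R\<^esub> a \<ominus>\<^bsub>R\<^esub> a \<otimes>\<^bsub>R\<^esub> u"
    using two_torsion[OF p2, of "a \<otimes>\<^bsub>R\<^esub> u"] by (simp add: R.minus_eq R.minus_equality)
  then have bracket: "u \<otimes>\<^bsub>R\<^esub> a \<oplus>\<^bsub>R\<^esub> a \<otimes>\<^bsub>R\<^esub> u \<in> J"
    using lie_bracket_in_J[of u a] by simp
  have "(u \<oplus>\<^bsub>R\<^esub> a) \<otimes>\<^bsub>R\<^esub> (u \<oplus>\<^bsub>R\<^esub> a) =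
      u \<otimes>\<^bsub>R\<^esub> u \<oplus>\<^bsub>R\<^esub> (a \<otimes>\<^bsub>R\<^esub> a \<oplus>\<^bsub>R\<^esub> (u \<otimes>\<^bsub>R\<^esub> a \<oplus>\<^bsub>R\<^esub> a \<otimes>\<^bsub>R\<^esub> u))"
    by (simp add: R.l_distr R.r_distr R.a_ac)
  also have "\<dots> = (s \<oplus>\<^bsub>R\<^esub> a \<otimes>\<^bsub>R\<^esub> a) \<oplus>\<^bsub>R\<^esub> (j \<oplus>\<^bsub>R\<^esub> (u \<otimes>\<^bsub>R\<^esub> a \<oplus>\<^bsub>R\<^esub> a \<otimes>\<^bsub>R\<^esub> u))"
    unfolding sj(3) by (simp add: R.a_ac)
  finally show ?case unfolding a_def[symmetric]
    using center_supported_add[OF sj(1) aa] J_add[OF sj(2) bracket] by blast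
qed

text \<open>
  Square \<open>u\<^sup>2 = s + j\<close> with \<open>s\<close> central and \<open>j\<close> in \<open>tR\<close>: the cross terms cancel in characteristic \<open>2\<close>,
  and \<open>j\<^sup>2\<close> lies in \<open>t\<^sup>2R = 0\<close>.
\<close>
lemma fourth_power_center_supported:
  assumes p2: "p = 2" and u: "u \<in> carrier R"
  shows "u [^]\<^bsub>R\<^esub> (4::nat) \<in> center_supported"
proof -
  obtain s j where sj: "s \<in> center_supported" "j \<in> J" "u \<otimes>\<^bsub>R\<^esub> u = s \<oplus>\<^bsub>R\<^esub> j"
    using square_decomposition[OF assms] by blast
  obtain r where r: "r \<in> carrier R" "j = t \<otimes>\<^bsub>R\<^esub> r" using sj(2) by (auto simp: J_def)
  have s: "s \<in> carrier R" using sj(1) by (rule center_supportedD)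
  have j: "j \<in> carrier R" using r by simp
  have tt: "t \<otimes>\<^bsub>R\<^esub> t = \<zero>\<^bsub>R\<^esub>" using t_pow_p by (simp add: p2 numeral_2_eq_2)
  have "j \<otimes>\<^bsub>R\<^esub> j = (t \<otimes>\<^bsub>R\<^esub> t) \<otimes>\<^bsub>R\<^esub> (r \<otimes>\<^bsub>R\<^esub> r)"
    unfolding r(2) using r t_comm[OF r(1)] by (metis R.m_assoc R.m_closed t_closed)
  then have jj: "j \<otimes>\<^bsub>R\<^esub> j = \<zero>\<^bsub>R\<^esub>" using r by (simp add: tt)
  have sj_comm: "s \<otimes>\<^bsub>R\<^esub> j = j \<otimes>\<^bsub>R\<^esub> s" using center_supported_commutes[OF sj(1) j] .
  have "u [^]\<^bsub>R\<^esub> (4::nat) = (u \<otimes>\<^bsub>R\<^esub> u) \<otimes>\<^bsub>R\<^esub> (u \<otimes>\<^bsub>R\<^esub> u)"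
    using u by (simp add: numeral_eq_Suc R.m_assoc)
  also have "\<dots> = s \<otimes>\<^bsub>R\<^esub> s \<oplus>\<^bsub>R\<^esub> (j \<otimes>\<^bsub>R\<^esub> s \<oplus>\<^bsub>R\<^esub> j \<otimes>\<^bsub>R\<^esub> s)"
    unfolding sj(3) using s j by (simp add: R.l_distr R.r_distr sj_comm jj R.a_assoc)
  also have "\<dots> = s \<otimes>\<^bsub>R\<^esub> s" using two_torsion[OF p2, of "j \<otimes>\<^bsub>R\<^esub> s"] s j by simp
  finally show ?thesis using center_supported_mult[OF sj(1) sj(1)] by simp
qed

text \<open>
  The element \<open>w = h(g - 1)\<close>. It has augmentation zero, so \<open>1 + w\<close> is normalized; and
  if \<open>gh = \<zeta>hg\<close> with \<open>\<zeta>\<close> central, then \<open>gwg\<^sup>-\<^sup>1 = \<zeta>w\<close>.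
\<close>
definition witness :: "'g \<Rightarrow> 'g \<Rightarrow> 'g \<Rightarrow> 'f" where
  "witness g h = basis (h \<otimes>\<^bsub>G\<^esub> g) \<oplus>\<^bsub>R\<^esub> single (\<ominus>\<^bsub>F\<^esub> \<one>\<^bsub>F\<^esub>) h"

text \<open>
  No commutator of \<open>g\<close> and \<open>1 + w\<close> has the properties shared by all products of \<open>p\<close>-th (for
  \<open>p = 2\<close>, of fourth) powers. The contradiction comes from the coefficient at \<open>h\<close>: it is \<open>-1\<close> in \<open>w\<close>,
  but zero in \<open>dw\<close> for every central \<open>d \<noteq> 1\<close>, because \<open>dh\<close> and \<open>dhg\<close> differ from \<open>h\<close>.
  For \<open>p\<close> odd this refutes \<open>(\<zeta> - 1)\<^sup>2 w = 0\<close>, as \<open>\<zeta>\<^sup>2 \<noteq> 1\<close>. For \<open>p = 2\<close> one has \<open>\<zeta>\<^sup>2 = 1\<close>, and the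
  stronger hypothesis on \<open>c\<close> is needed to obtain \<open>(\<zeta> - 1) w = 0\<close>.
\<close>
lemma no_commutator_relation:
  assumes g [simp]: "g \<in> carrier G" and h [simp]: "h \<in> carrier G"
    and nc: "g \<otimes>\<^bsub>G\<^esub> h \<noteq> h \<otimes>\<^bsub>G\<^esub> g"
    and c [simp]: "c \<in> carrier R"
    and cg: "c \<otimes>\<^bsub>R\<^esub> basis g = basis g \<otimes>\<^bsub>R\<^esub> c"
    and c2: "p = 2 \<Longrightarrow> c \<in> center_supported"
    and rel: "(\<one>\<^bsub>R\<^esub> \<oplus>\<^bsub>R\<^esub> witness g h) \<otimes>\<^bsub>R\<^esub> basis g \<otimes>\<^bsub>R\<^esub> c = basis g \<otimes>\<^bsub>R\<^esub> (\<one>\<^bsub>R\<^esub> \<oplus>\<^bsub>R\<^esub> witness g h)"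
  shows False
proof -
  define w where "w = witness g h"
  have w [simp]: "w \<in> carrier R" by (simp add: w_def witness_def)
  obtain i :: nat where i: "g \<otimes>\<^bsub>G\<^esub> h = z [^]\<^bsub>G\<^esub> i \<otimes>\<^bsub>G\<^esub> (h \<otimes>\<^bsub>G\<^esub> g)"
    using commutator_z[OF g h] by auto
  define \<zeta> where "\<zeta> = z [^]\<^bsub>G\<^esub> i"
  have \<zeta>: "central \<zeta>" unfolding \<zeta>_def by (rule central_pow[OF central_z])
  have \<zeta>c [simp]: "\<zeta> \<in> carrier G" using \<zeta> by (rule centralD)
  have \<zeta>1: "\<zeta> \<noteq> \<one>\<^bsub>G\<^esub>" using nc i by (auto simp: \<zeta>_def)
  have \<zeta>p: "\<zeta> [^]\<^bsub>G\<^esub> p = \<one>\<^bsub>G\<^esub>"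
  proof -
    have "\<zeta> [^]\<^bsub>G\<^esub> p = (z [^]\<^bsub>G\<^esub> p) [^]\<^bsub>G\<^esub> i" by (simp add: \<zeta>_def G.nat_pow_pow mult.commute)
    then show ?thesis by (simp add: z_pow_p)
  qed
  have gh: "g \<otimes>\<^bsub>G\<^esub> h = \<zeta> \<otimes>\<^bsub>G\<^esub> (h \<otimes>\<^bsub>G\<^esub> g)" using i by (simp add: \<zeta>_def)
  have ncg: "\<not> central g" using nc centralD(2)[of g h] by auto
  have nch: "\<not> central h" using nc centralD(2)[of h g] by auto
  have nchg: "\<not> central (h \<otimes>\<^bsub>G\<^esub> g)"
  proof
    assume "central (h \<otimes>\<^bsub>G\<^esub> g)"
    then have "g \<otimes>\<^bsub>G\<^esub> (h \<otimes>\<^bsub>G\<^esub> g) = h \<otimes>\<^bsub>G\<^esub> g \<otimes>\<^bsub>G\<^esub> g" by (rule centralD) simp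
    then have "(g \<otimes>\<^bsub>G\<^esub> h) \<otimes>\<^bsub>G\<^esub> g = (h \<otimes>\<^bsub>G\<^esub> g) \<otimes>\<^bsub>G\<^esub> g" by (simp add: G.m_assoc)
    then show False using nc by simp
  qed
  have ne_hg: "d \<otimes>\<^bsub>G\<^esub> (h \<otimes>\<^bsub>G\<^esub> g) \<noteq> h" if d: "central d" for d
  proof
    assume "d \<otimes>\<^bsub>G\<^esub> (h \<otimes>\<^bsub>G\<^esub> g) = h"
    then have "h \<otimes>\<^bsub>G\<^esub> (d \<otimes>\<^bsub>G\<^esub> g) = h \<otimes>\<^bsub>G\<^esub> \<one>\<^bsub>G\<^esub>"
      using d centralD(2)[OF d h] by (simp add: centralD(1) G.m_assoc[symmetric])
    then have "d \<otimes>\<^bsub>G\<^esub> g = \<one>\<^bsub>G\<^esub>" using d by (subst (asm) G.l_cancel) (auto simp: centralD(1))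
    then have "g = inv\<^bsub>G\<^esub> d" using d centralD(1)[OF d] by (metis G.inv_equality G.inv_inv g)
    then show False using central_inv[OF d] ncg by simp
  qed
  have ne_h: "d \<otimes>\<^bsub>G\<^esub> h = h \<longleftrightarrow> d = \<one>\<^bsub>G\<^esub>" if d: "d \<in> carrier G" for d
    using d by simp
  have xw: "basis g \<otimes>\<^bsub>R\<^esub> w = basis \<zeta> \<otimes>\<^bsub>R\<^esub> w \<otimes>\<^bsub>R\<^esub> basis g"
    by (simp add: w_def witness_def R.r_distr R.l_distr G.m_assoc[symmetric] gh)
  have \<zeta>_comm: "basis \<zeta> \<otimes>\<^bsub>R\<^esub> v = v \<otimes>\<^bsub>R\<^esub> basis \<zeta>" if "v \<in> carrier R" for v
    by (rule center_supported_commutes[OF single_center_supported[OF _ \<zeta>] that]) simp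
  have inv: "basis g \<otimes>\<^bsub>R\<^esub> basis (inv\<^bsub>G\<^esub> g) = \<one>\<^bsub>R\<^esub>" by (simp add: one_eq_single)
  note rel' = R.commuting_commutator_relation[of "basis g" "basis (inv\<^bsub>G\<^esub> g)" w "basis \<zeta>" c,
      OF _ _ _ _ _ inv \<zeta>_comm \<zeta>_comm xw cg rel[folded w_def]]
  have wh: "w h = \<ominus>\<^bsub>F\<^esub> \<one>\<^bsub>F\<^esub>"
    using ne_hg[OF central_one] by (simp add: w_def witness_def eq_commute[of h])
  have \<zeta>w: "(basis d \<otimes>\<^bsub>R\<^esub> w) h = \<zero>\<^bsub>F\<^esub>" if d: "central d" "d \<noteq> \<one>\<^bsub>G\<^esub>" for d
    using ne_hg[OF d(1)] ne_h[of d] d centralD(1)[OF d(1)]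
    by (simp add: w_def witness_def R.r_distr eq_commute[of h])
  have minus_one: "\<ominus>\<^bsub>F\<^esub> \<one>\<^bsub>F\<^esub> \<noteq> \<zero>\<^bsub>F\<^esub>"
    using one_not_zero by (metis F.minus_minus F.minus_zero F.one_closed)
  show False
  proof (cases "p = 2")
    case False
    have "\<zeta> \<otimes>\<^bsub>G\<^esub> \<zeta> \<noteq> \<one>\<^bsub>G\<^esub>"
    proof
      assume "\<zeta> \<otimes>\<^bsub>G\<^esub> \<zeta> = \<one>\<^bsub>G\<^esub>"
      then have "G.ord \<zeta> dvd 2" by (simp add: G.pow_eq_id[symmetric] numeral_2_eq_2)
      moreover have "G.ord \<zeta> dvd p" using \<zeta>p by (simp add: G.pow_eq_id[symmetric])
      moreover have "coprime 2 p" using primes_coprime[OF two_is_prime_nat p] False by auto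
      ultimately have "G.ord \<zeta> = 1" by (metis coprime_common_divisor_nat)
      then show False using \<zeta>1 G.ord_eq_1[OF \<zeta>c] by simp
    qed
    then have "(basis \<zeta> \<otimes>\<^bsub>R\<^esub> basis \<zeta> \<otimes>\<^bsub>R\<^esub> w) h = \<zero>\<^bsub>F\<^esub>"
      using \<zeta>w[OF central_mult[OF \<zeta> \<zeta>]] by simp
    then have "(w \<oplus>\<^bsub>R\<^esub> basis \<zeta> \<otimes>\<^bsub>R\<^esub> basis \<zeta> \<otimes>\<^bsub>R\<^esub> w) h = \<ominus>\<^bsub>F\<^esub> \<one>\<^bsub>F\<^esub>"
      by (simp add: wh del: single_mult_single)
    moreover have "(basis \<zeta> \<otimes>\<^bsub>R\<^esub> w \<oplus>\<^bsub>R\<^esub> basis \<zeta> \<otimes>\<^bsub>R\<^esub> w) h = \<zero>\<^bsub>F\<^esub>"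
      by (simp add: \<zeta>w[OF \<zeta> \<zeta>1])
    moreover have "w \<oplus>\<^bsub>R\<^esub> basis \<zeta> \<otimes>\<^bsub>R\<^esub> basis \<zeta> \<otimes>\<^bsub>R\<^esub> w = basis \<zeta> \<otimes>\<^bsub>R\<^esub> w \<oplus>\<^bsub>R\<^esub> basis \<zeta> \<otimes>\<^bsub>R\<^esub> w"
      by (rule rel'(2)) auto
    ultimately show False using minus_one by metis
  next
    case True
    note cs = c2[OF True]
    have noncentral_inv: "\<not> central (inv\<^bsub>G\<^esub> x \<otimes>\<^bsub>G\<^esub> k)" if "\<not> central x" "x \<in> carrier G" "central k" for x k
    proof
      assume "central (inv\<^bsub>G\<^esub> x \<otimes>\<^bsub>G\<^esub> k)"
      then have "central (k \<otimes>\<^bsub>G\<^esub> inv\<^bsub>G\<^esub> (inv\<^bsub>G\<^esub> x \<otimes>\<^bsub>G\<^esub> k))"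
        by (intro central_mult[OF that(3)] central_inv)
      then show False using that centralD(1)[OF that(3)]
        by (simp add: G.inv_mult_group G.m_assoc[symmetric])
    qed
    have noncentral_mult: "\<not> central (\<zeta> \<otimes>\<^bsub>G\<^esub> x)" if "\<not> central x" "x \<in> carrier G" for x
    proof
      assume "central (\<zeta> \<otimes>\<^bsub>G\<^esub> x)"
      then have "central (inv\<^bsub>G\<^esub> \<zeta> \<otimes>\<^bsub>G\<^esub> (\<zeta> \<otimes>\<^bsub>G\<^esub> x))"
        by (rule central_mult[OF central_inv[OF \<zeta>]])
      then show False using that by (simp add: G.m_assoc[symmetric])
    qed
    \<comment> \<open>Compare coefficients of \<open>(1 + w) c = 1 + \<zeta>w\<close> at a central \<open>k\<close>: as \<open>h\<close> and \<open>hg\<close> are not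
      central, neither \<open>wc\<close> nor \<open>\<zeta>w\<close> contributes.\<close>
    have "c = \<one>\<^bsub>R\<^esub>"
    proof (rule group_ring_eqI)
      fix k assume k [simp]: "k \<in> carrier G"
      show "c k = \<one>\<^bsub>R\<^esub> k"
      proof (cases "central k")
        case False
        then show ?thesis
          using central_one center_supportedD(2)[OF cs k] by (auto simp: one_eq_single)
      next
        case True
        have "((\<one>\<^bsub>R\<^esub> \<oplus>\<^bsub>R\<^esub> w) \<otimes>\<^bsub>R\<^esub> c) k = c k"
          using center_supportedD(2)[OF cs _ noncentral_inv[OF nch h True]]
            center_supportedD(2)[OF cs _ noncentral_inv[OF nchg _ True]]
          by (simp add: R.l_distr w_def witness_def single_mult_apply)
        moreover have "(\<one>\<^bsub>R\<^esub> \<oplus>\<^bsub>R\<^esub> basis \<zeta> \<otimes>\<^bsub>R\<^esub> w) k = \<one>\<^bsub>R\<^esub> k"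
        proof -
          have "k \<noteq> \<zeta> \<otimes>\<^bsub>G\<^esub> h" "k \<noteq> \<zeta> \<otimes>\<^bsub>G\<^esub> (h \<otimes>\<^bsub>G\<^esub> g)"
            using True noncentral_mult[OF nch h] noncentral_mult[OF nchg] by auto
          then show ?thesis by (simp add: w_def witness_def R.r_distr)
        qed
        ultimately show ?thesis using rel'(1) by simp
      qed
    qed auto
    then have "\<one>\<^bsub>R\<^esub> \<oplus>\<^bsub>R\<^esub> w = \<one>\<^bsub>R\<^esub> \<oplus>\<^bsub>R\<^esub> basis \<zeta> \<otimes>\<^bsub>R\<^esub> w" using rel'(1) by simp
    then have "w = basis \<zeta> \<otimes>\<^bsub>R\<^esub> w" 
      by (rule R.add.l_cancel) auto
    then show False using wh \<zeta>w[OF \<zeta> \<zeta>1] minus_one by simp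
  qed
qed

end

section \<open>Normalized units\<close>

lemma ring_char_torsion:
  assumes "ring_char F = p" "p > 0"
  shows "[p] \<cdot>\<^bsub>F\<^esub> \<one>\<^bsub>F\<^esub> = \<zero>\<^bsub>F\<^esub>"
proof -
  have ex: "\<exists>n::nat. n > 0 \<and> [n] \<cdot>\<^bsub>F\<^esub> \<one>\<^bsub>F\<^esub> = \<zero>\<^bsub>F\<^esub>"
    using assms unfolding ring_char_def by (auto split: if_splits)
  then have "p = (LEAST n::nat. n > 0 \<and> [n] \<cdot>\<^bsub>F\<^esub> \<one>\<^bsub>F\<^esub> = \<zero>\<^bsub>F\<^esub>)"
    using assms unfolding ring_char_def by (auto split: if_splits)
  then show ?thesis using LeastI_ex[OF ex] by simp
qed

context group_ring
begin

abbreviation V :: "('g \<Rightarrow> 'f) monoid" where "V \<equiv> normalized_units F G"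

lemma carrier_V: "carrier V = {u \<in> carrier R. aug u = \<one>\<^bsub>F\<^esub>}"
  and mult_V: "u \<otimes>\<^bsub>V\<^esub> v = u \<otimes>\<^bsub>R\<^esub> v"
  and one_V: "\<one>\<^bsub>V\<^esub> = \<one>\<^bsub>R\<^esub>"
  and pow_V: "u [^]\<^bsub>V\<^esub> (n::nat) = u [^]\<^bsub>R\<^esub> n"
  by (simp_all add: normalized_units_def aug_def nat_pow_def)

lemma monoid_V: "monoid V"
  by (rule monoidI) (auto simp: carrier_V mult_V one_V R.m_assoc, simp add: one_eq_single)

lemma mult_comm_if_comm_group:
  assumes "comm_group G" "u \<in> carrier R" "v \<in> carrier R"
  shows "u \<otimes>\<^bsub>R\<^esub> v = v \<otimes>\<^bsub>R\<^esub> u"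
proof (rule center_supported_commutes[OF _ assms(3)])
  have "central g" if "g \<in> carrier G" for g
    using comm_group.axioms(1)[OF assms(1)] that by (auto simp: central_def comm_monoid.m_comm)
  then show "u \<in> center_supported" using assms(2) by (auto simp: center_supported_def)
qed

text \<open>
  By Frobenius it suffices to consider a multiple \<open>\<alpha>x\<close> of a group element, where
  \<open>(\<alpha>x)\<^sup>q = \<alpha>\<^sup>q\<close> for \<open>q = p\<^sup>n\<close>.
\<close>
lemma exponent_power_if_comm_group:
  assumes comm: "comm_group G" and p: "Factorial_Ring.prime (p::nat)"
    and torsion: "[p] \<cdot>\<^bsub>F\<^esub> \<one>\<^bsub>F\<^esub> = \<zero>\<^bsub>F\<^esub>"
    and exponent: "\<And>x. x \<in> carrier G \<Longrightarrow> x [^]\<^bsub>G\<^esub> (p ^ n) = \<one>\<^bsub>G\<^esub>"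
    and u: "u \<in> carrier R"
  shows "u [^]\<^bsub>R\<^esub> (p ^ n) = single (aug u [^]\<^bsub>F\<^esub> (p ^ n)) \<one>\<^bsub>G\<^esub>"
  using u
proof (induction u rule: group_ring_induct)
  case zero
  have "p ^ n > 0" using prime_gt_0_nat[OF p] by simp
  then obtain k where k: "p ^ n = Suc k" by (cases "p ^ n") auto
  have "aug \<zero>\<^bsub>R\<^esub> = \<zero>\<^bsub>F\<^esub>"
    unfolding aug_def by (rule F.add.finprod_one_eqI) auto
  moreover have "single \<zero>\<^bsub>F\<^esub> \<one>\<^bsub>G\<^esub> = \<zero>\<^bsub>R\<^esub>" by (rule group_ring_eqI) auto
  ultimately show ?case unfolding k by simp
next
  case (add_single u \<alpha> x)
  note [simp] = \<open>u \<in> carrier R\<close> \<open>\<alpha> \<in> carrier F\<close> \<open>x \<in> carrier G\<close>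
  have "(u \<oplus>\<^bsub>R\<^esub> single \<alpha> x) [^]\<^bsub>R\<^esub> (p ^ n) = u [^]\<^bsub>R\<^esub> (p ^ n) \<oplus>\<^bsub>R\<^esub> single \<alpha> x [^]\<^bsub>R\<^esub> (p ^ n)"
    by (rule R.frobenius_add_iterated[OF p torsion_R[OF torsion]])
      (auto intro: mult_comm_if_comm_group[OF comm])
  also have "\<dots> = single (aug u [^]\<^bsub>F\<^esub> (p ^ n)) \<one>\<^bsub>G\<^esub> \<oplus>\<^bsub>R\<^esub> single (\<alpha> [^]\<^bsub>F\<^esub> (p ^ n)) \<one>\<^bsub>G\<^esub>"
    using add_single by (simp add: single_pow exponent)
  also have "\<dots> = single (aug u [^]\<^bsub>F\<^esub> (p ^ n) \<oplus>\<^bsub>F\<^esub> \<alpha> [^]\<^bsub>F\<^esub> (p ^ n)) \<one>\<^bsub>G\<^esub>"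
    by (rule group_ring_eqI) auto
  also have "aug u [^]\<^bsub>F\<^esub> (p ^ n) \<oplus>\<^bsub>F\<^esub> \<alpha> [^]\<^bsub>F\<^esub> (p ^ n) = (aug u \<oplus>\<^bsub>F\<^esub> \<alpha>) [^]\<^bsub>F\<^esub> (p ^ n)"
    by (rule F.frobenius_add_iterated[OF p torsion, symmetric]) (auto intro: F.m_comm)
  finally show ?case by simp
qed

text \<open>
  Since \<open>u\<^sup>q = 1\<close> for \<open>q = |G|\<close>, the power \<open>u\<^sup>q\<^sup>-\<^sup>1\<close> is an inverse of \<open>u\<close>, and \<open>V(FG)\<close> has \<open>p\<close>-power order.
\<close>
lemma powerful_if_comm_group:
  assumes comm: "comm_group G" and p: "Factorial_Ring.prime (p::nat)"
    and torsion: "[p] \<cdot>\<^bsub>F\<^esub> \<one>\<^bsub>F\<^esub> = \<zero>\<^bsub>F\<^esub>" and finF: "finite (carrier F)"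
    and order: "order G = p ^ n"
  shows "powerful p V"
proof -
  have exponent: "u [^]\<^bsub>V\<^esub> (p ^ n) = \<one>\<^bsub>V\<^esub>" if "u \<in> carrier V" for u
    using exponent_power_if_comm_group[OF comm p torsion, of n u] that G.pow_order_eq_1 order
    by (simp add: carrier_V pow_V one_V one_eq_single)
  interpret V: monoid V by (rule monoid_V)
  have "p ^ n > 0" using prime_gt_0_nat[OF p] by simp
  then obtain k where k: "p ^ n = Suc k" by (cases "p ^ n") auto
  have "\<exists>v\<in>carrier V. v \<otimes>\<^bsub>V\<^esub> u = \<one>\<^bsub>V\<^esub>" if "u \<in> carrier V" for u
    using exponent[OF that] that unfolding k by (intro bexI[of _ "u [^]\<^bsub>V\<^esub> k"]) auto
  then interpret V: group V
    by (intro V.group_l_invI) auto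
  have comm_V: "a \<otimes>\<^bsub>V\<^esub> b = b \<otimes>\<^bsub>V\<^esub> a" if "a \<in> carrier V" "b \<in> carrier V" for a b
    using that by (simp add: carrier_V mult_V mult_comm_if_comm_group[OF comm])
  have fin: "finite (carrier V)"
    by (rule finite_subset[of _ "carrier R"])
      (auto simp: carrier_V carrier_R intro: finite_PiE finite_group finF)
  obtain m where "order V = p ^ m"
    using V.prime_power_order_if_exponent[OF p fin exponent] by blast
  moreover have "commutator V a b = \<one>\<^bsub>V\<^esub>" if ab: "a \<in> carrier V" "b \<in> carrier V" for a b
  proof -
    have "commutator V a b = inv\<^bsub>V\<^esub> b \<otimes>\<^bsub>V\<^esub> inv\<^bsub>V\<^esub> a \<otimes>\<^bsub>V\<^esub> a \<otimes>\<^bsub>V\<^esub> b"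
      using ab by (simp add: commutator_def comm_V[of "inv\<^bsub>V\<^esub> a"])
    then show ?thesis using ab by (simp add: V.m_assoc)
  qed
  moreover have "is_product_of_powers V k \<one>\<^bsub>V\<^esub>" for k
    unfolding is_product_of_powers_def by (rule exI[of _ "[]"]) simp
  ultimately show ?thesis
    using V.is_group fin by (auto simp: powerful_def finite_p_group_def)
qed

end

text \<open>
  Lift noncommuting elements of the minimal nonabelian quotient \<open>H\<close> to \<open>a\<close> and \<open>b\<close> in \<open>G\<close>, and map the
  commutator of the units \<open>a\<close> and \<open>1 + b(a - 1)\<close> of \<open>FG\<close> to \<open>FH\<close>. Writing the commutator relation without
  inverses makes it an identity in the ring \<open>FG\<close>, which the ring homomorphism to \<open>FH\<close> preserves.
\<close>
lemma (in group_ring) comm_group_if_powerful: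
  assumes p: "Factorial_Ring.prime p" and torsion: "[p] \<cdot>\<^bsub>F\<^esub> \<one>\<^bsub>F\<^esub> = \<zero>\<^bsub>F\<^esub>"
    and one_not_zero: "\<one>\<^bsub>F\<^esub> \<noteq> \<zero>\<^bsub>F\<^esub>"
    and G: "finite_p_group p G" and powerful: "powerful p V"
  shows "comm_group G"
proof (rule ccontr)
  assume "\<not> comm_group G"
  then obtain N z where N: "N \<lhd> G" and z: "z \<in> carrier (G Mod N)" "z [^]\<^bsub>G Mod N\<^esub> p = \<one>\<^bsub>G Mod N\<^esub>"
    "\<And>x. x \<in> carrier (G Mod N) \<Longrightarrow> x \<otimes>\<^bsub>G Mod N\<^esub> z = z \<otimes>\<^bsub>G Mod N\<^esub> x"
    "\<And>x y. x \<in> carrier (G Mod N) \<Longrightarrow> y \<in> carrier (G Mod N) \<Longrightarrow>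
      \<exists>i::nat. x \<otimes>\<^bsub>G Mod N\<^esub> y = z [^]\<^bsub>G Mod N\<^esub> i \<otimes>\<^bsub>G Mod N\<^esub> (y \<otimes>\<^bsub>G Mod N\<^esub> x)"
    and nc: "\<exists>x\<in>carrier (G Mod N). \<exists>y\<in>carrier (G Mod N). x \<otimes>\<^bsub>G Mod N\<^esub> y \<noteq> y \<otimes>\<^bsub>G Mod N\<^esub> x"
    using that by (rule nonabelian_p_group_minimal_quotient[OF p G])
  define H where "H = G Mod N"
  define \<phi> where "\<phi> = (\<lambda>x. N #>\<^bsub>G\<^esub> x)"
  interpret H: group H unfolding H_def by (rule normal.factorgroup_is_group[OF N])
  have carrier_H: "carrier H = \<phi> ` carrier G"
    by (simp add: H_def \<phi>_def carrier_FactGroup)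
  interpret H: group_ring F H
    by unfold_locales (simp add: carrier_H finite_group)
  interpret group_ring_push F G H \<phi>
    by unfold_locales (simp add: H_def \<phi>_def normal.r_coset_hom_Mod[OF N])
  interpret H: central_commutator_group_ring F H p z
    by unfold_locales (use z p torsion one_not_zero in \<open>auto simp: H_def[symmetric] H.central_def\<close>)
  obtain a b where ab: "a \<in> carrier G" "b \<in> carrier G" and
    nc_ab: "\<phi> a \<otimes>\<^bsub>H\<^esub> \<phi> b \<noteq> \<phi> b \<otimes>\<^bsub>H\<^esub> \<phi> a"
    using nc unfolding H_def[symmetric] carrier_H by blast
  define x where "x = basis a"
  define y where "y = \<one>\<^bsub>R\<^esub> \<oplus>\<^bsub>R\<^esub> (basis (b \<otimes>\<^bsub>G\<^esub> a) \<oplus>\<^bsub>R\<^esub> single (\<ominus>\<^bsub>F\<^esub> \<one>\<^bsub>F\<^esub>) b)"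
  have x: "x \<in> carrier V" using ab by (simp add: x_def carrier_V)
  have y: "y \<in> carrier V" using ab by (simp add: y_def carrier_V F.r_neg one_eq_single)
  have [simp]: "x \<in> carrier R" "y \<in> carrier R" using x y by (simp_all add: carrier_V)
  interpret V: group V using powerful by (simp add: powerful_def finite_p_group_def)
  define c where "c = commutator V x y"
  have c_eq: "y \<otimes>\<^bsub>R\<^esub> x \<otimes>\<^bsub>R\<^esub> c = x \<otimes>\<^bsub>R\<^esub> y"
    using V.mult_commutator[OF x y] by (simp add: c_def mult_V)
  define k :: nat where "k = (if p = 2 then 4 else p)"
  obtain us where us: "set us \<subseteq> carrier V" "c = foldr (\<otimes>\<^bsub>R\<^esub>) (map (\<lambda>u. u [^]\<^bsub>R\<^esub> k) us) \<one>\<^bsub>R\<^esub>"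
  proof -
    have "is_product_of_powers V k c"
      using powerful x y unfolding powerful_def k_def c_def by blast
    moreover have "(\<otimes>\<^bsub>V\<^esub>) = (\<otimes>\<^bsub>R\<^esub>)" by (simp add: normalized_units_def)
    ultimately show thesis
      using that unfolding is_product_of_powers_def pow_V one_V by auto
  qed
  have usR: "set us \<subseteq> carrier R" using us by (auto simp: carrier_V)
  have basis_a: "H.basis (\<phi> a) \<in> carrier H.R" using ab by simp
  \<comment> \<open>This set is closed under multiplication and contains all \<open>k\<close>-th powers of \<open>FH\<close>.\<close>
  have "push c \<in> {s \<in> carrier H.R. s \<otimes>\<^bsub>H.R\<^esub> H.basis (\<phi> a) = H.basis (\<phi> a) \<otimes>\<^bsub>H.R\<^esub> s
      \<and> (p = 2 \<longrightarrow> s \<in> H.center_supported)}" (is "_ \<in> ?S")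
  proof -
    have "s \<otimes>\<^bsub>H.R\<^esub> s' \<in> ?S" if ss: "s \<in> ?S" "s' \<in> ?S" for s s'
    proof -
      have "s \<otimes>\<^bsub>H.R\<^esub> s' \<otimes>\<^bsub>H.R\<^esub> H.basis (\<phi> a) = H.basis (\<phi> a) \<otimes>\<^bsub>H.R\<^esub> (s \<otimes>\<^bsub>H.R\<^esub> s')"
        by (rule H.R.commutes_mult) (use ss basis_a in simp_all)
      then show ?thesis using ss H.center_supported_mult by auto
    qed
    moreover have "v [^]\<^bsub>H.R\<^esub> k \<in> ?S" if v: "v \<in> carrier H.R" for v
    proof (cases "p = 2")
      case True
      then have "v [^]\<^bsub>H.R\<^esub> k \<in> H.center_supported"
        using H.fourth_power_center_supported v by (simp add: k_def)
      then show ?thesis using H.center_supported_commutes[OF _ basis_a] v by simp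
    qed (use H.pow_p_commutes[OF v basis_a] v in \<open>simp add: k_def\<close>)
    moreover have "\<one>\<^bsub>H.R\<^esub> \<in> ?S"
      using basis_a H.single_center_supported[OF _ H.central_one]
      by (simp add: H.one_eq_single[symmetric]) (simp add: H.one_eq_single)
    ultimately show ?thesis using push_product_of_powers[OF usR, of ?S k] us(2) by blast
  qed
  moreover have "push y = \<one>\<^bsub>H.R\<^esub> \<oplus>\<^bsub>H.R\<^esub> H.witness (\<phi> a) (\<phi> b)"
    using ab by (simp add: y_def H.witness_def push_add push_one hom_mult[OF hom])
  moreover have "push x = H.basis (\<phi> a)" using ab by (simp add: x_def)
  moreover have "c \<in> carrier V" using x y by (simp add: c_def commutator_def)
  then have "c \<in> carrier R" by (simp add: carrier_V)
  then have "push y \<otimes>\<^bsub>H.R\<^esub> push x \<otimes>\<^bsub>H.R\<^esub> push c = push x \<otimes>\<^bsub>H.R\<^esub> push y"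
    using arg_cong[OF c_eq, of "push"] by (simp add: push_mult)
  ultimately show False
    using H.no_commutator_relation[of "\<phi> a" "\<phi> b" "push c"] ab nc_ab by auto
qed

theorem theorem0p1:
  fixes p :: nat
    and F :: "('f, 'r) ring_scheme"
    and G :: "('g, 'm) monoid_scheme"
  assumes "Factorial_Ring.prime p"
    and "field F" and "finite (carrier F)" and "ring_char F = p"
    and "finite_p_group p G"
  shows "powerful p (normalized_units F G) \<longleftrightarrow> comm_group G"
proof -
  interpret F: field F by fact
  interpret G: group G using assms(5) by (simp add: finite_p_group_def)
  interpret group_ring F G
    by unfold_locales (use assms(5) in \<open>simp add: finite_p_group_def\<close>)
  have torsion: "[p] \<cdot>\<^bsub>F\<^esub> \<one>\<^bsub>F\<^esub> = \<zero>\<^bsub>F\<^esub>"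
    using ring_char_torsion[OF assms(4)] prime_gt_0_nat[OF assms(1)] .
  obtain n where n: "order G = p ^ n" using assms(5) by (auto simp: finite_p_group_def)
  have "powerful p V" if "comm_group G"
    by (rule powerful_if_comm_group[OF that assms(1) torsion assms(3) n])
  moreover have "comm_group G" if "powerful p V"
    by (rule comm_group_if_powerful[OF assms(1) torsion _ assms(5) that]) simp
  ultimately show ?thesis by blast
qed

end
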